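(* Let $f:[0,\infty)\times\mathbb{R}^d\to\mathbb{R}^d$ be continuous in $t$ and have continuous first order partial derivatives with respect to $x$, and suppose the solution $x(t)=x(t;x_0)$ of $\dot x(t)=f(t,x)$, $x(0)=x_0$, exists for all $t\ge0$. Then the $E(t)$ of the solution $x(t;x_0)$ and the $E(t)$ of the zero solution of $\dot y(t)=A(t)y$, $y(0)=0$, where $A(t)=\frac{\partial f(t,x)}{\partial x}\big|_{x=x(t;x_0)}$, are the same. In fact, for all $t\ge0$, $$E(t)=\sup_{v}\Big\|\int_0^t\frac{\partial x(t)}{\partial x(s)}\,v(s)\,ds\Big\|,$$ where the supremum is taken over continuous functions $v:[0,t]\to\mathbb{R}^d$ satisfying $\|v(s)\|\le1$ for $0\le s\le t$.
   Context: Norms are Euclidean. Continuity of the partial derivatives is understood jointly in $(t,x)$. $\frac{\partial x(t)}{\partial x(s)}$ is the $d\times d$ Jacobian at $\xi=x(s;x_0)$ of the map $\xi\mapsto x(t;s,\xi)$, where $x(t;s,\xi)$ is the solution of $\dot x=f(t,x)$ with $x(s)=\xi$. Definition of $E$: let $\dot y=F(t,y)$ with $F(t,0)\equiv0$, $F$ continuous in $t$ and locally Lipschitz in $y$, and let $y(t;s,\eta)$ denote the solution with $y(s)=\eta$. Let $\alpha:[0,\infty)\to[0,\infty)$ be any continuous strictly increasing function with $\alpha(0)=0$. For $h>0$ the family $\tilde Y_\alpha(h)$ of approximations to the zero solution consists of all functions $\tilde y(\cdot;h)$ obtained from sequences $v_1,v_2,\dots\in\mathbb{R}^d$ with $\|v_n\|\le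 1$ by $\tilde y(0;h)=0$, $\tilde y(nh;h)=y(nh;(n-1)h,\tilde y((n-1)h;h))+h\alpha(h)v_n$ for $n\ge1$, and $\tilde y(t;h)=y(t;(n-1)h,\tilde y((n-1)h;h))$ for $(n-1)h\le t<nh$. For every $T>0$ all these approximations exist on $[0,T]$ once $h$ is small enough. Define $e_\alpha(t;h)=\sup_{\tilde y\in\tilde Y_\alpha(h)}\|\tilde y(t;h)\|$ and $E(t)=E_\alpha(t)=\limsup_{h\to0^+} e_\alpha(t;h)/\alpha(h)$; this value does not depend on the choice of $\alpha$. The $E(t)$ of a solution $x(t;x_0)$ of $\dot x=f(t,x)$ is by definition the $E(t)$ of the zero solution of $\dot y=f(t,y+x(t;x_0))-f(t,x(t;x_0))$. *)

theory Defs
  imports "HOL-Analysis.Analysis"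
begin

definition ode_solution ::
  "(real \<Rightarrow> real^'d \<Rightarrow> real^'d) \<Rightarrow> real set \<Rightarrow> (real \<Rightarrow> real^'d) \<Rightarrow> bool" where
  "ode_solution F I y \<longleftrightarrow> (\<forall>u\<in>I. (y has_vector_derivative F u (y u)) (at u within I))"

text \<open>The value \<open>y(t; s, \<eta>)\<close> at time \<open>t\<close> of the solution with \<open>y(s) = \<eta>\<close>. Solutions need not be
  global: if none reaches from \<open>s\<close> to \<open>t\<close>, the value is unspecified.\<close>

definition ode_flow ::
  "(real \<Rightarrow> real^'d \<Rightarrow> real^'d) \<Rightarrow> real \<Rightarrow> real \<Rightarrow> real^'d \<Rightarrow> real^'d" where
  "ode_flow F t s \<eta> =
     (THE z. \<exists>y. ode_solution F (closed_segment s t) y \<and> y s = \<eta> \<and> y t = z)"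

definition admissible_rate :: "(real \<Rightarrow> real) \<Rightarrow> bool" where
  "admissible_rate \<alpha> \<longleftrightarrow> continuous_on {0..} \<alpha> \<and> strict_mono_on {0..} \<alpha> \<and> \<alpha> 0 = 0"

text \<open>\<open>approx_node F \<alpha> h v n\<close> is the approximation at the grid point \<open>n h\<close>.\<close>

primrec approx_node ::
  "(real \<Rightarrow> real^'d \<Rightarrow> real^'d) \<Rightarrow> (real \<Rightarrow> real) \<Rightarrow> real \<Rightarrow> (nat \<Rightarrow> real^'d) \<Rightarrow> nat \<Rightarrow> real^'d" where
  "approx_node F \<alpha> h v 0 = 0"
| "approx_node F \<alpha> h v (Suc n) =
     ode_flow F (real (Suc n) * h) (real n * h) (approx_node F \<alpha> h v n) + (h * \<alpha> h) *\<^sub>R v (Suc n)"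

text \<open>For \<open>t \<ge> 0\<close> and \<open>h > 0\<close>, the index \<open>n = \<lfloor>t / h\<rfloor>\<close> is the one with \<open>n h \<le> t < (n + 1) h\<close>.\<close>

definition approx ::
  "(real \<Rightarrow> real^'d \<Rightarrow> real^'d) \<Rightarrow> (real \<Rightarrow> real) \<Rightarrow> real \<Rightarrow> (nat \<Rightarrow> real^'d) \<Rightarrow> real \<Rightarrow> real^'d" where
  "approx F \<alpha> h v t =
     (let n = nat \<lfloor>t / h\<rfloor> in ode_flow F t (real n * h) (approx_node F \<alpha> h v n))"

definition approximations ::
  "(real \<Rightarrow> real^'d \<Rightarrow> real^'d) \<Rightarrow> (real \<Rightarrow> real) \<Rightarrow> real \<Rightarrow> (real \<Rightarrow> real^'d) set" where
  "approximations F \<alpha> h = {approx F \<alpha> h v | v. \<forall>n\<ge>1. norm (v n) \<le> 1}"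

definition max_error ::
  "(real \<Rightarrow> real^'d \<Rightarrow> real^'d) \<Rightarrow> (real \<Rightarrow> real) \<Rightarrow> real \<Rightarrow> real \<Rightarrow> ereal" where
  "max_error F \<alpha> t h = (SUP y\<in>approximations F \<alpha> h. ereal (norm (y t)))"

text \<open>\<open>E(t)\<close> of the zero solution of \<open>y' = F(t, y)\<close>. Step sizes for which some approximation fails
  to exist on \<open>[0, t]\<close> do not matter, since only arbitrarily small \<open>h\<close> enter the limit superior.\<close>

definition E_zero ::
  "(real \<Rightarrow> real) \<Rightarrow> (real \<Rightarrow> real^'d \<Rightarrow> real^'d) \<Rightarrow> real \<Rightarrow> ereal" where
  "E_zero \<alpha> F t = Limsup (at_right 0) (\<lambda>h. max_error F \<alpha> t h / ereal (\<alpha> h))"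

definition E_solution ::
  "(real \<Rightarrow> real) \<Rightarrow> (real \<Rightarrow> real^'d \<Rightarrow> real^'d) \<Rightarrow> (real \<Rightarrow> real^'d) \<Rightarrow> real \<Rightarrow> ereal" where
  "E_solution \<alpha> f x t = E_zero \<alpha> (\<lambda>u y. f u (y + x u) - f u (x u)) t"

text \<open>\<open>Df t x\<close> is the matrix of first order partial derivatives of \<open>f\<close> with respect to the
  components of \<open>x\<close> (rows: components of \<open>f\<close>), on the domain \<open>t \<ge> 0\<close>.\<close>

definition has_state_partials ::
  "(real \<Rightarrow> real^'d \<Rightarrow> real^'d) \<Rightarrow> (real \<Rightarrow> real^'d \<Rightarrow> real^'d^'d) \<Rightarrow> bool" where
  "has_state_partials f Df \<longleftrightarrow>
     (\<forall>t\<ge>0. \<forall>x i j.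
        ((\<lambda>r. f t (x + r *\<^sub>R axis j 1) $ i) has_real_derivative Df t x $ i $ j) (at 0))"

end

(* On a fixed interval [0,T] let y' = F(t,y) have the linearization A(t) at the zero solution, and let
   S(b,a) be the propagator of y' = A(t) y.  A flow step of F from a to b differs from S(b,a) by
   o(|y|) (b - a), uniformly for small |y|.  Transporting all nodes to time T by S(T,.) makes the
   recursion telescope: up to o(\<alpha>(h)), every approximation at time T is
   h \<alpha>(h) \<Sum>_j S(T,jh) v_j.  So E(T) is the limit of the maximal norm of these right Riemann sums, which
   by duality (the best v in the direction p is parallel to S(T,s)^* p) is the supremum of
   |\<integral> S(T,s) v(s) ds|.  This value depends on A only, which gives the equality of both E(T), and
   S(t,s) is the Jacobian of the flow of f along the given solution. *)

theory Submission
  imports Defs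
begin

section \<open>Gronwall's inequality and global existence\<close>

text \<open>The error of one flow step must carry the factor \<open>b - a\<close>: there are about
  T/h steps, and a bare o(\<alpha>(h)) per step would not add up to o(\<alpha>(h)). The bound o(|y|)
  is useful only once the nodes are O(\<alpha>(h)), which itself rests on the flow being near the
  propagator; one induction establishes the two together. A solution of \<open>F\<close> may also
  blow up, and \<open>ode_flow\<close> is then an unspecified value, so solutions with small initial
  data have to be constructed. Finally, the sequences \<open>v\<close> need not resemble a
  continuous function as h tends to 0. Pairing with a direction p removes them: what remains is a
  Riemann sum of |S(T,s)^* p|, which is Lipschitz in s with a constant common to all unit vectors
  p.\<close>

lemma ode_gronwall:
  fixes d :: "real \<Rightarrow> 'a::real_normed_vector"
  assumes der: "\<And>u. u \<in> {a..b} \<Longrightarrow> (d has_vector_derivative d' u) (at u within {a..b})"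
    and bd: "\<And>u. u \<in> {a..b} \<Longrightarrow> norm (d' u) \<le> K * norm (d u) + m"
    and Km: "0 \<le> K" "0 \<le> m" and u: "u \<in> {a..b}"
  shows "norm (d u) \<le> (norm (d a) + m * (u - a)) * exp (K * (u - a))"
proof -
  have cont: "continuous_on {a..b} d"
    using der by (rule continuous_on_vector_derivative)
  define g where "g = (\<lambda>\<tau>. K * norm (d \<tau>) + m)"
  have contg: "continuous_on {a..b} g"
    unfolding g_def by (intro continuous_intros cont)
  \<comment> \<open>The norm need not be differentiable, so it is replaced by the differentiable
    majorant \<open>H\<close>, whose derivative is at most \<open>K * H + m\<close>.\<close>
  define H where "H = (\<lambda>u. norm (d a) + integral {a..u} g)"
  have H_der: "(H has_real_derivative g v) (at v within {a..b})" if "v \<in> {a..b}" for v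
  proof -
    have "((\<lambda>u. integral {a..u} g) has_real_derivative g v) (at v within {a..b})"
      using integral_has_vector_derivative[OF contg that]
      by (simp add: has_real_derivative_iff_has_vector_derivative)
    then show ?thesis unfolding H_def by (auto intro!: derivative_eq_intros)
  qed
  have H_cont: "continuous_on {a..b} H"
    using H_der by (rule DERIV_continuous_on)
  have dH: "norm (d v) \<le> H v" if v: "v \<in> {a..b}" for v
  proof (cases "v = a")
    case True then show ?thesis by (simp add: H_def)
  next
    case False
    with v have av: "a < v" by auto
    have "norm (d v - d a) \<le> H v - H a"
    proof (rule differentiable_bound_general[OF av])
      show "continuous_on {a..v} d" "continuous_on {a..v} H"
        using cont H_cont v by (auto elim: continuous_on_subset)
      fix x assume x: "a < x" "x < v"
      then have ab: "x \<in> {a..b}" and at: "at x within {a..b} = at x"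
        using v by (auto intro!: at_within_Icc_at)
      show "(d has_vector_derivative d' x) (at x)" using der[OF ab] at by simp
      show "(H has_vector_derivative g x) (at x)"
        using H_der[OF ab] at by (simp add: has_real_derivative_iff_has_vector_derivative)
      show "norm (d' x) \<le> g x" using bd[OF ab] by (simp add: g_def)
    qed
    moreover have "H a = norm (d a)" by (simp add: H_def)
    moreover have "norm (d v) \<le> norm (d a) + norm (d v - d a)"
      by (metis add.commute norm_triangle_sub)
    ultimately show ?thesis by linarith
  qed
  \<comment> \<open>Nonincreasing by the bound on the derivative of \<open>H\<close>; comparing its
    values at \<open>u\<close> and \<open>a\<close> gives the claim for \<open>H\<close>.\<close>
  define P where "P = (\<lambda>u. H u * exp (- K * (u - a)) - m * (u - a))"
  have P_der: "(P has_real_derivative (g v - K * H v) * exp (- K * (v - a)) - m) (at v within {a..b})"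
    if "v \<in> {a..b}" for v
    unfolding P_def
    by (rule derivative_eq_intros H_der that refl | simp)+ (simp add: algebra_simps)
  have "P a \<ge> P u"
  proof (rule DERIV_nonpos_imp_decreasing_open[where f = P])
    show "a \<le> u" using u by simp
    have "continuous_on {a..b} P" using P_der by (rule DERIV_continuous_on)
    then show "continuous_on {a..u} P" by (rule continuous_on_subset) (use u in auto)
    fix v assume v: "a < v" "v < u"
    then have ab: "v \<in> {a..b}" and at: "at v within {a..b} = at v"
      using u by (auto intro!: at_within_Icc_at)
    have "g v - K * H v \<le> m"
      using mult_left_mono[OF dH[OF ab] Km(1)] by (simp add: g_def)
    then have "(g v - K * H v) * exp (- K * (v - a)) \<le> m * exp (- K * (v - a))"
      by (intro mult_right_mono) auto
    also have "\<dots> \<le> m * 1"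
      using Km v by (intro mult_left_mono) auto
    finally show "\<exists>y. (P has_real_derivative y) (at v) \<and> y \<le> 0"
      using P_der[OF ab] at by auto
  qed
  then have "H u * exp (- K * (u - a)) \<le> norm (d a) + m * (u - a)"
    by (simp add: P_def H_def)
  from mult_right_mono[OF this, of "exp (K * (u - a))"]
  have "H u \<le> (norm (d a) + m * (u - a)) * exp (K * (u - a))"
    by (simp add: mult.assoc flip: exp_add)
  with dH[OF u] show ?thesis by linarith
qed

text \<open>The Picard operator acts on \<open>z(u) = exp(- k (u - a)) y(u)\<close>, which makes it a contraction on an
  interval of any length.\<close>

lemma ode_picard:
  fixes F :: "real \<Rightarrow> real^'d \<Rightarrow> real^'d"
  assumes ab: "a \<le> b"
    and cont: "continuous_on ({a..b} \<times> UNIV) (\<lambda>(u, y). F u y)"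
    and L: "0 \<le> L"
    and lip: "\<And>u y z. u \<in> {a..b} \<Longrightarrow> norm (F u y - F u z) \<le> L * norm (y - z)"
  obtains y where "ode_solution F {a..b} y" "y a = \<eta>"
proof -
  \<comment> \<open>Any \<open>k > L\<close> makes \<open>L / k\<close> less than 1; the summand 1
    covers \<open>L = 0\<close>.\<close>
  define k where "k = 2 * L + 1"
  have k: "k > 0" "L / k < 1" "L / k \<ge> 0" using L by (auto simp: k_def field_simps)
  \<comment> \<open>Clamping time to [a,b] extends functions on the interval to bounded continuous
    functions on the whole line, the complete space in which the fixed point is found.\<close>
  define cl where "cl = (\<lambda>u. max a (min b u))"
  have cl: "cl u \<in> {a..b}" for u using ab by (auto simp: cl_def)
  have cl_id: "cl u = u" if "u \<in> {a..b}" for u using that by (auto simp: cl_def)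
  have cl_cont: "continuous_on S cl" for S unfolding cl_def by (intro continuous_intros)
  define rhs where "rhs = (\<lambda>(z :: real \<Rightarrow>\<^sub>C (real^'d)) \<tau>. F \<tau> (exp (k * (\<tau> - a)) *\<^sub>R apply_bcontfun z \<tau>))"
  have rhs_cont: "continuous_on {a..b} (rhs z)" for z
  proof -
    have "continuous_on {a..b} (\<lambda>\<tau>. (\<lambda>(u, y). F u y) (\<tau>, exp (k * (\<tau> - a)) *\<^sub>R apply_bcontfun z \<tau>))"
      by (rule continuous_on_compose2[OF cont]) (auto intro!: continuous_intros)
    then show ?thesis by (simp add: rhs_def)
  qed
  define Q where "Q = (\<lambda>z u. exp (- k * (u - a)) *\<^sub>R (\<eta> + integral {a..u} (rhs z)))"
  have Q_cont: "continuous_on {a..b} (Q z)" for z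
    unfolding Q_def
    by (intro continuous_intros indefinite_integral_continuous_1 integrable_continuous_real rhs_cont)
  have Qb: "(\<lambda>u. Q z (cl u)) \<in> bcontfun" for z
  proof -
    have "bounded (Q z ` {a..b})"
      by (intro compact_imp_bounded compact_continuous_image Q_cont) simp
    then have "bounded (range (\<lambda>u. Q z (cl u)))"
      by (rule bounded_subset) (use cl in auto)
    moreover have "continuous_on UNIV (\<lambda>u. Q z (cl u))"
      by (rule continuous_on_compose2[OF Q_cont cl_cont]) (use cl in auto)
    ultimately show ?thesis by (simp add: bcontfun_def)
  qed
  define T where "T = (\<lambda>z. Bcontfun (\<lambda>u. Q z (cl u)))"
  have T_app: "apply_bcontfun (T z) u = Q z (cl u)" for z u
    by (simp add: T_def Bcontfun_inverse[OF Qb])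
  have est: "norm (Q z u - Q w u) \<le> L / k * dist z w" if u: "u \<in> {a..b}" for z w u
  proof -
    have sub: "{a..u} \<subseteq> {a..b}" using u by auto
    have int: "rhs z integrable_on {a..u}" for z
      by (rule integrable_continuous_real[OF continuous_on_subset[OF rhs_cont sub]])
    have "Q z u - Q w u = exp (- k * (u - a)) *\<^sub>R integral {a..u} (\<lambda>\<tau>. rhs z \<tau> - rhs w \<tau>)"
      by (simp add: Q_def Henstock_Kurzweil_Integration.integral_diff[OF int int] algebra_simps)
    moreover have "norm (integral {a..u} (\<lambda>\<tau>. rhs z \<tau> - rhs w \<tau>))
        \<le> integral {a..u} (\<lambda>\<tau>. L * dist z w * exp (k * (\<tau> - a)))"
    proof (rule integral_norm_bound_integral)
      show "(\<lambda>\<tau>. rhs z \<tau> - rhs w \<tau>) integrable_on {a..u}"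
        by (intro integrable_diff int)
      show "(\<lambda>\<tau>. L * dist z w * exp (k * (\<tau> - a))) integrable_on {a..u}"
        by (intro integrable_continuous_real continuous_intros)
      fix \<tau> assume \<tau>: "\<tau> \<in> {a..u}"
      then have "norm (rhs z \<tau> - rhs w \<tau>) \<le> L * (exp (k * (\<tau> - a)) * norm (apply_bcontfun z \<tau> - apply_bcontfun w \<tau>))"
        using lip[of \<tau> "exp (k * (\<tau> - a)) *\<^sub>R apply_bcontfun z \<tau>" "exp (k * (\<tau> - a)) *\<^sub>R apply_bcontfun w \<tau>"] u
        by (auto simp: rhs_def simp flip: scaleR_diff_right)
      also have "\<dots> \<le> L * (exp (k * (\<tau> - a)) * dist z w)"
        using dist_bounded[of z \<tau> w] L by (intro mult_left_mono) (auto simp: dist_norm)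
      finally show "norm (rhs z \<tau> - rhs w \<tau>) \<le> L * dist z w * exp (k * (\<tau> - a))" by (simp add: algebra_simps)
    qed
    moreover have "((\<lambda>\<tau>. L * dist z w * exp (k * (\<tau> - a))) has_integral
        (L * dist z w / k * exp (k * (u - a)) - L * dist z w / k * exp (k * (a - a)))) {a..u}"
      using u k by (intro fundamental_theorem_of_calculus)
        (auto intro!: derivative_eq_intros simp flip: has_real_derivative_iff_has_vector_derivative)
    ultimately have "norm (Q z u - Q w u) \<le> exp (- k * (u - a)) * (L * dist z w / k * exp (k * (u - a)) - L * dist z w / k)"
      by (auto dest!: integral_unique)
    also have "\<dots> = L / k * dist z w - exp (- k * (u - a)) * (L * dist z w / k)"
      by (simp add: algebra_simps flip: exp_add)
    also have "\<dots> \<le> L / k * dist z w" using L k by simp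
    finally show ?thesis .
  qed
  have "dist (T z) (T w) \<le> L / k * dist z w" for z w
    by (rule dist_bound) (use est cl in \<open>auto simp: T_app dist_norm\<close>)
  then obtain z where z: "T z = z"
    using banach_fix_type[of "L / k" T] k by auto
  define y where "y = (\<lambda>u. \<eta> + integral {a..u} (rhs z))"
  have zy: "apply_bcontfun z u = exp (- k * (u - a)) *\<^sub>R y u" if "u \<in> {a..b}" for u
    using T_app[of z u] that by (simp add: z cl_id Q_def y_def)
  have "rhs z u = F u (y u)" if "u \<in> {a..b}" for u
    using zy[OF that] by (simp add: rhs_def flip: exp_add)
  then have "ode_solution F {a..b} y"
    unfolding ode_solution_def y_def
    using integral_has_vector_derivative[OF rhs_cont, of _ z] by (auto intro!: derivative_eq_intros)
  then show ?thesis by (rule that) (simp add: y_def)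
qed

section \<open>Uniqueness and the linear propagator\<close>

lemma norm_matrix_vector_mult_le:
  fixes M :: "real^'n^'m"
  shows "norm (M *v y) \<le> real CARD('m) * real CARD('n) * norm M * norm y"
proof -
  have "\<bar>M $ i $ j\<bar> \<le> norm M" for i j
    using component_le_norm_cart[of "M $ i" j] Finite_Cartesian_Product.norm_nth_le[of M i]
    by (simp only: order_trans)
  then have "onorm ((*v) M) \<le> real CARD('m) * real CARD('n) * norm M"
    by (rule onorm_le_matrix_component)
  then show ?thesis
    by (intro order_trans[OF onorm[OF matrix_vector_mul_bounded_linear, of M y]] mult_right_mono) auto
qed

lemma continuous_on_matrix_vector_mult:
  fixes M :: "'b::topological_space \<Rightarrow> real^'n^'m"
  assumes "continuous_on S M" "continuous_on S g"
  shows "continuous_on S (\<lambda>u. M u *v g u)"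
  unfolding matrix_mult_dot by (intro continuous_intros assms)

lemma ode_solution_subset:
  "ode_solution F I y \<Longrightarrow> J \<subseteq> I \<Longrightarrow> ode_solution F J y"
  unfolding ode_solution_def by (auto intro: has_vector_derivative_within_subset)

lemma ode_solution_continuous_on: "ode_solution F I y \<Longrightarrow> continuous_on I y"
  unfolding ode_solution_def by (rule continuous_on_vector_derivative) (rule bspec)

section \<open>Uniqueness and flow values for locally Lipschitz fields\<close>

locale lipschitz_ode =
  fixes F :: "real \<Rightarrow> real^'d \<Rightarrow> real^'d" and T :: real
  assumes locally_lipschitz:
    "\<And>M. \<exists>L\<ge>0. \<forall>u\<in>{0..T}. \<forall>y\<in>cball 0 M. \<forall>z\<in>cball 0 M. norm (F u y - F u z) \<le> L * norm (y - z)"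
begin

lemma ode_solution_unique:
  assumes y: "ode_solution F {a..b} y" and z: "ode_solution F {a..b} z" and eq: "y a = z a"
    and ab: "0 \<le> a" "b \<le> T" and u: "u \<in> {a..b}"
  shows "y u = z u"
proof -
  have "bounded (y ` {a..b} \<union> z ` {a..b})"
    using y z by (intro bounded_Un[THEN iffD2] conjI compact_imp_bounded compact_continuous_image
      ode_solution_continuous_on) auto
  then obtain M where M: "\<And>w. w \<in> y ` {a..b} \<union> z ` {a..b} \<Longrightarrow> norm w \<le> M"
    by (auto simp: bounded_iff)
  obtain L where L: "L \<ge> 0" "\<And>u y z. u \<in> {0..T} \<Longrightarrow> y \<in> cball 0 M \<Longrightarrow> z \<in> cball 0 M \<Longrightarrow>
      norm (F u y - F u z) \<le> L * norm (y - z)"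
    using locally_lipschitz[of M] by blast
  have "norm (y u - z u) \<le> (norm (y a - z a) + 0 * (u - a)) * exp (L * (u - a))"
  proof (rule ode_gronwall[where d' = "\<lambda>u. F u (y u) - F u (z u)" and b = b])
    show "((\<lambda>u. y u - z u) has_vector_derivative F u (y u) - F u (z u)) (at u within {a..b})"
      if "u \<in> {a..b}" for u
      using y z that unfolding ode_solution_def by (intro has_vector_derivative_diff) auto
    show "norm (F v (y v) - F v (z v)) \<le> L * norm (y v - z v) + 0" if "v \<in> {a..b}" for v
      using that ab M L(2)[of v "y v" "z v"] by auto
  qed (use L u in auto)
  with eq show ?thesis by simp
qed

text \<open>Uniqueness turns the definite description into a value as soon as some solution up to
  \<open>b\<close> is exhibited. Later values of \<open>ode_flow\<close> are computed in this way,
  after existence has been supplied.\<close>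

lemma ode_flow_eq:
  assumes y: "ode_solution F {a..b} y" and "0 \<le> a" "a \<le> b" "b \<le> T"
  shows "ode_flow F b a (y a) = y b"
  unfolding ode_flow_def closed_segment_eq_real_ivl1[OF \<open>a \<le> b\<close>]
proof (rule the_equality)
  show "\<exists>w. ode_solution F {a..b} w \<and> w a = y a \<and> w b = y b" using y by blast
  show "z = y b" if "\<exists>w. ode_solution F {a..b} w \<and> w a = y a \<and> w b = z" for z
    using that ode_solution_unique[OF y _ _ \<open>0 \<le> a\<close> \<open>b \<le> T\<close>, of _ b] \<open>a \<le> b\<close> by fastforce
qed

end

section \<open>The propagator of the linear equation and its bounds\<close>

locale linear_ode =
  fixes A :: "real \<Rightarrow> real^'d^'d" and T :: real
  assumes T_nonneg: "0 \<le> T" and continuous_on_A: "continuous_on {0..T} A"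
begin

definition K where
  "K = (SOME K. 0 \<le> K \<and> (\<forall>u\<in>{0..T}. \<forall>y. norm (A u *v y) \<le> K * norm y))"

lemma K_nonneg: "0 \<le> K" and norm_A_le: "u \<in> {0..T} \<Longrightarrow> norm (A u *v y) \<le> K * norm y"
proof -
  have "bounded (A ` {0..T})"
    by (intro compact_imp_bounded compact_continuous_image continuous_on_A) simp
  then obtain B where B: "\<And>u. u \<in> {0..T} \<Longrightarrow> norm (A u) \<le> B"
    unfolding bounded_iff by blast
  then have B0: "0 \<le> B" using T_nonneg norm_ge_zero[of "A 0"] by (meson atLeastAtMost_iff order_refl order_trans)
  have "norm (A u *v y) \<le> real CARD('d) * real CARD('d) * B * norm y" if "u \<in> {0..T}" for u y
    by (rule order_trans[OF norm_matrix_vector_mult_le])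
      (intro mult_right_mono mult_left_mono B that; simp)
  then have "\<exists>K. 0 \<le> K \<and> (\<forall>u\<in>{0..T}. \<forall>y. norm (A u *v y) \<le> K * norm y)"
    using B0 by (intro exI[of _ "real CARD('d) * real CARD('d) * B"]) auto
  from someI_ex[OF this] show "0 \<le> K" "u \<in> {0..T} \<Longrightarrow> norm (A u *v y) \<le> K * norm y"
    unfolding K_def by blast+
qed

sublocale lin: lipschitz_ode "\<lambda>u y. A u *v y" T
proof
  show "\<exists>L\<ge>0. \<forall>u\<in>{0..T}. \<forall>y\<in>cball 0 M. \<forall>z\<in>cball 0 M.
      norm (A u *v y - A u *v z) \<le> L * norm (y - z)" for M
    by (intro exI[of _ K] conjI ballI K_nonneg)
      (simp add: norm_A_le flip: matrix_vector_mult_diff_distrib)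
qed

definition S where "S b a = ode_flow (\<lambda>u y. A u *v y) b a"

text \<open>The linear field is globally Lipschitz, so its solution reaches from \<open>a\<close> to
  \<open>b\<close>. One \<open>y\<close> represents \<open>S u a \<eta>\<close> at all intermediate
  \<open>u\<close>; the semigroup law and the estimate of \<open>S b a \<eta> - \<eta>\<close> rest
  on this.\<close>

lemma linear_solution:
  assumes "0 \<le> a" "a \<le> b" "b \<le> T"
  obtains y where "ode_solution (\<lambda>u y. A u *v y) {a..b} y" "y a = \<eta>"
    "\<And>u. u \<in> {a..b} \<Longrightarrow> S u a \<eta> = y u"
proof -
  have cA: "continuous_on {a..b} A"
    using continuous_on_A by (rule continuous_on_subset) (use assms in auto)
  have "continuous_on ({a..b} \<times> UNIV) (\<lambda>p. A (fst p) *v snd p)"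
    by (intro continuous_on_matrix_vector_mult continuous_intros continuous_on_compose2[OF cA]) auto
  then have "continuous_on ({a..b} \<times> UNIV) (\<lambda>(u, y). A u *v y)"
    by (simp add: case_prod_beta)
  then obtain y where y: "ode_solution (\<lambda>u y. A u *v y) {a..b} y" "y a = \<eta>"
  proof (rule ode_picard[OF \<open>a \<le> b\<close>, where F = "\<lambda>u y. A u *v y" and L = K and \<eta> = \<eta>])
    show "norm (A u *v y - A u *v z) \<le> K * norm (y - z)" if "u \<in> {a..b}" for u y z
      using that assms by (simp add: norm_A_le flip: matrix_vector_mult_diff_distrib)
  qed (use K_nonneg in auto)
  show ?thesis
  proof (rule that[OF y])
    fix u assume u: "u \<in> {a..b}"
    have "ode_solution (\<lambda>u y. A u *v y) {a..u} y"
      using y(1) by (rule ode_solution_subset) (use u in auto)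
    from lin.ode_flow_eq[OF this] show "S u a \<eta> = y u"
      using u assms y by (simp add: S_def)
  qed
qed

lemma S_eq:
  assumes "ode_solution (\<lambda>u y. A u *v y) {a..b} y" "0 \<le> a" "a \<le> b" "b \<le> T"
  shows "S b a (y a) = y b"
  using lin.ode_flow_eq[OF assms] by (simp add: S_def)

lemma S_semigroup:
  assumes "0 \<le> a" "a \<le> b" "b \<le> c" "c \<le> T"
  shows "S c b (S b a \<eta>) = S c a \<eta>"
proof -
  obtain y where y: "ode_solution (\<lambda>u y. A u *v y) {a..c} y" "y a = \<eta>"
    "\<And>u. u \<in> {a..c} \<Longrightarrow> S u a \<eta> = y u"
    using linear_solution[of a c \<eta>] assms by auto
  have "ode_solution (\<lambda>u y. A u *v y) {b..c} y"
    using y(1) by (rule ode_solution_subset) (use assms in auto)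
  from S_eq[OF this] show ?thesis using y(3)[of b] y(3)[of c] assms by simp
qed

lemma S_linear:
  assumes "0 \<le> a" "a \<le> b" "b \<le> T"
  shows "linear (S b a)"
proof (rule linearI)
  fix \<eta> \<zeta> :: "real^'d" and c :: real
  obtain y where y: "ode_solution (\<lambda>u y. A u *v y) {a..b} y" "y a = \<eta>"
    using linear_solution[OF assms] by metis
  obtain z where z: "ode_solution (\<lambda>u y. A u *v y) {a..b} z" "z a = \<zeta>"
    using linear_solution[OF assms] by metis
  have "ode_solution (\<lambda>u y. A u *v y) {a..b} (\<lambda>u. y u + z u)"
    using y z unfolding ode_solution_def
    by (auto simp: matrix_vector_right_distrib intro!: has_vector_derivative_add)
  from S_eq[OF this assms] S_eq[OF y(1) assms] S_eq[OF z(1) assms] y z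
  show "S b a (\<eta> + \<zeta>) = S b a \<eta> + S b a \<zeta>" by simp
  have "ode_solution (\<lambda>u y. A u *v y) {a..b} (\<lambda>u. c *\<^sub>R y u)"
    using y unfolding ode_solution_def
    by (auto simp: matrix_vector_mult_scaleR intro!: derivative_eq_intros)
  from S_eq[OF this assms] S_eq[OF y(1) assms] y
  show "S b a (c *\<^sub>R \<eta>) = c *\<^sub>R S b a \<eta>" by simp
qed

text \<open>The exponent has to be proportional to \<open>b - a\<close>: over the steps of an
  approximation these factors multiply, and only in this form does their product stay bounded as h
  tends to 0.\<close>

lemma norm_S_le:
  assumes "0 \<le> a" "a \<le> b" "b \<le> T"
  shows "norm (S b a \<eta>) \<le> exp (K * (b - a)) * norm \<eta>"
proof -
  obtain y where y: "ode_solution (\<lambda>u y. A u *v y) {a..b} y" "y a = \<eta>"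
    using linear_solution[OF assms] by metis
  have "norm (y b) \<le> (norm (y a) + 0 * (b - a)) * exp (K * (b - a))"
    by (rule ode_gronwall[where d' = "\<lambda>u. A u *v y u" and b = b])
      (use y assms norm_A_le K_nonneg in \<open>auto simp: ode_solution_def\<close>)
  with y S_eq[OF y(1) assms] show ?thesis by (simp add: mult.commute)
qed

definition C where "C = exp (K * T)"

lemma C_ge_1: "1 \<le> C" using K_nonneg T_nonneg by (simp add: C_def)

lemma norm_S_le_C:
  assumes "0 \<le> a" "a \<le> b" "b \<le> T"
  shows "norm (S b a \<eta>) \<le> C * norm \<eta>"
proof -
  have "exp (K * (b - a)) \<le> C"
    using assms K_nonneg by (auto simp: C_def intro!: mult_left_mono)
  then show ?thesis using norm_S_le[OF assms, of \<eta>] by (meson mult_right_mono norm_ge_zero order_trans)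
qed

lemma norm_S_minus_id_le:
  assumes "0 \<le> a" "a \<le> b" "b \<le> T"
  shows "norm (S b a \<eta> - \<eta>) \<le> K * C * (b - a) * norm \<eta>"
proof -
  obtain y where y: "ode_solution (\<lambda>u y. A u *v y) {a..b} y" "y a = \<eta>"
      "\<And>u. u \<in> {a..b} \<Longrightarrow> S u a \<eta> = y u"
    using linear_solution[OF assms] by metis
  \<comment> \<open>With growth rate 0, Gronwall's inequality is the mean value inequality.\<close>
  have "norm (y b - \<eta>) \<le> (norm (y a - \<eta>) + K * (C * norm \<eta>) * (b - a)) * exp (0 * (b - a))"
  proof (rule ode_gronwall[where d' = "\<lambda>u. A u *v y u" and b = b])
    show "((\<lambda>u. y u - \<eta>) has_vector_derivative A u *v y u) (at u within {a..b})" if "u \<in> {a..b}" for u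
      using y(1) that by (auto simp: ode_solution_def intro!: derivative_eq_intros)
    show "norm (A u *v y u) \<le> 0 * norm (y u - \<eta>) + K * (C * norm \<eta>)" if "u \<in> {a..b}" for u
    proof -
      have "norm (A u *v y u) \<le> K * norm (y u)" using that assms by (intro norm_A_le) auto
      also have "\<dots> \<le> K * (C * norm \<eta>)"
        using norm_S_le_C[of a u \<eta>] y(3)[OF that] that assms K_nonneg by (intro mult_left_mono) auto
      finally show ?thesis by simp
    qed
  qed (use assms K_nonneg C_ge_1 in auto)
  with y(2) S_eq[OF y(1) assms] show ?thesis by (simp add: algebra_simps)
qed

text \<open>For \<open>s \<le> r\<close> the difference is \<open>S T r\<close> applied to
  \<open>S r s \<eta> - \<eta>\<close>; one factor \<open>C\<close> comes from \<open>S T r\<close>,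
  the other from the estimate of its argument.\<close>

lemma S_lipschitz:
  assumes "s \<in> {0..T}" "r \<in> {0..T}"
  shows "norm (S T s \<eta> - S T r \<eta>) \<le> K * C\<^sup>2 * \<bar>s - r\<bar> * norm \<eta>"
  using assms
proof (induction s r rule: linorder_wlog)
  case (le s r)
  have "S T s \<eta> - S T r \<eta> = S T r (S r s \<eta> - \<eta>)"
    using le S_semigroup[of s r T] by (simp add: linear_diff[OF S_linear])
  also have "norm \<dots> \<le> C * (K * C * (r - s) * norm \<eta>)"
    using le C_ge_1 by (intro order_trans[OF norm_S_le_C] mult_left_mono norm_S_minus_id_le) auto
  finally show ?case using le by (simp add: power2_eq_square algebra_simps)
next
  case (sym s r) then show ?case by (simp add: norm_minus_commute abs_minus_commute)
qed

end

section \<open>Comparison of the approximations with linear sums\<close>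

lemma admissible_rate_pos: "admissible_rate \<alpha> \<Longrightarrow> h > 0 \<Longrightarrow> \<alpha> h > 0"
  unfolding admissible_rate_def strict_mono_on_def by (metis atLeast_iff less_eq_real_def order_refl)

lemma admissible_rate_tendsto:
  assumes "admissible_rate \<alpha>"
  shows "(\<alpha> \<longlongrightarrow> 0) (at_right 0)"
proof -
  have "\<forall>x\<in>{0..}. (\<alpha> \<longlongrightarrow> \<alpha> x) (at x within {0..})"
    using assms by (simp add: admissible_rate_def continuous_on_def)
  then have "(\<alpha> \<longlongrightarrow> \<alpha> 0) (at 0 within {0..})" by blast
  then have "(\<alpha> \<longlongrightarrow> \<alpha> 0) (at_right 0)" by (rule tendsto_within_subset) auto
  then show ?thesis using assms by (simp add: admissible_rate_def)
qed

text \<open>A common frame for the two systems of the claim: the perturbation equation and its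
  linearization share \<open>A\<close>, hence the propagator, and differ in
  \<open>F\<close>.\<close>

locale linearized_ode = linear_ode A T + lipschitz_ode F T
  for A :: "real \<Rightarrow> real^'d^'d" and F :: "real \<Rightarrow> real^'d \<Rightarrow> real^'d" and T :: real +
  assumes continuous_on_F: "continuous_on ({0..T} \<times> UNIV) (\<lambda>(u, y). F u y)"
    and F_zero: "u \<in> {0..T} \<Longrightarrow> F u 0 = 0"
    and linearization:
      "\<epsilon> > 0 \<Longrightarrow> \<exists>r>0. \<forall>u\<in>{0..T}. \<forall>y\<in>cball 0 r. norm (F u y - A u *v y) \<le> \<epsilon> * norm y"
begin

text \<open>Solutions of \<open>F\<close> itself need not be global. Those with small initial values are obtained from a
  globally Lipschitz field, namely \<open>F\<close> precomposed with the projection onto a small ball.\<close>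

lemma solution_near_linear:
  assumes "\<epsilon> > 0"
  shows "\<exists>\<delta>>0. \<forall>a b \<eta>. 0 \<le> a \<longrightarrow> a \<le> b \<longrightarrow> b \<le> T \<longrightarrow> norm \<eta> \<le> \<delta> \<longrightarrow>
    (\<exists>y. ode_solution F {a..b} y \<and> y a = \<eta> \<and> norm (y b - S b a \<eta>) \<le> \<epsilon> * (b - a) * norm \<eta>)"
proof -
  obtain L where L: "L \<ge> 0" "\<And>u y z. u \<in> {0..T} \<Longrightarrow> y \<in> cball 0 1 \<Longrightarrow> z \<in> cball 0 1 \<Longrightarrow>
      norm (F u y - F u z) \<le> L * norm (y - z)"
    using locally_lipschitz[of 1] by blast
  define D where "D = exp (L * T)"
  have D: "D \<ge> 1" using L T_nonneg by (simp add: D_def)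
  \<comment> \<open>\<open>D\<close> is lost in bounding the solution by its initial value,
    \<open>C\<close> in Gronwall's inequality for the difference.\<close>
  define e where "e = \<epsilon> / (D * C)"
  have e: "e > 0" using assms D C_ge_1 by (simp add: e_def)
  obtain r0 where r0: "r0 > 0" "\<And>u y. u \<in> {0..T} \<Longrightarrow> norm y \<le> r0 \<Longrightarrow> norm (F u y - A u *v y) \<le> e * norm y"
    using linearization[OF e] by auto
  define r where "r = min r0 1"
  have r: "r > 0" "r \<le> r0" "r \<le> 1" using r0 by (auto simp: r_def)
  \<comment> \<open>Projection onto a ball of radius at most 1 does not increase distances, so the
    Lipschitz constant of \<open>F\<close> on the unit ball becomes a global one.\<close>
  define cp where "cp = closest_point (cball (0::real^'d) r)"
  have ball: "convex (cball (0::real^'d) r)" "closed (cball (0::real^'d) r)" "cball (0::real^'d) r \<noteq> {}"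
    using r by auto
  have cp_in: "cp y \<in> cball 0 r" for y unfolding cp_def by (rule closest_point_in_set) (use ball in auto)
  have cp_id: "cp y = y" if "norm y \<le> r" for y
    unfolding cp_def by (rule closest_point_self) (use that in simp)
  have cp_lip: "norm (cp y - cp z) \<le> norm (y - z)" for y z
    using closest_point_lipschitz[OF ball, of y z] by (simp add: cp_def dist_norm)
  have cp_cont: "continuous_on UNIV cp" unfolding cp_def by (rule continuous_on_closest_point[OF ball])
  define F' where "F' = (\<lambda>u y. F u (cp y))"
  have F'_lip: "norm (F' u y - F' u z) \<le> L * norm (y - z)" if "u \<in> {0..T}" for u y z
  proof -
    have "norm (F' u y - F' u z) \<le> L * norm (cp y - cp z)"
      unfolding F'_def using cp_in[of y] cp_in[of z] r that by (intro L) auto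
    also have "\<dots> \<le> L * norm (y - z)" using L cp_lip by (intro mult_left_mono)
    finally show ?thesis .
  qed
  show ?thesis
  \<comment> \<open>A solution of the truncated field grows at most by the factor \<open>D\<close>.
    Starting within radius \<open>r / D\<close> it stays in the ball of radius \<open>r\<close>,
    where the two fields agree.\<close>
  proof (intro exI[of _ "r / D"] conjI allI impI)
    show "r / D > 0" using r D by simp
    fix a b :: real and \<eta> :: "real^'d" assume ab: "0 \<le> a" "a \<le> b" "b \<le> T" and \<eta>: "norm \<eta> \<le> r / D"
    have sub: "u \<in> {0..T}" if "u \<in> {a..b}" for u using that ab by auto
    have "continuous_on ({a..b} \<times> UNIV) (\<lambda>p. (\<lambda>(u, y). F u y) (fst p, cp (snd p)))"
      by (rule continuous_on_compose2[OF continuous_on_F])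
        (use ab in \<open>auto intro!: continuous_intros continuous_on_compose2[OF cp_cont]\<close>)
    then have F'_cont: "continuous_on ({a..b} \<times> UNIV) (\<lambda>(u, y). F' u y)"
      by (simp add: F'_def case_prod_beta)
    obtain y where y: "ode_solution F' {a..b} y" "y a = \<eta>"
      using ode_picard[OF ab(2) F'_cont L(1) F'_lip[OF sub], of \<eta>] by blast
    have y_le: "norm (y u) \<le> D * norm \<eta>" if u: "u \<in> {a..b}" for u
    proof -
      have "norm (y u) \<le> (norm (y a) + 0 * (u - a)) * exp (L * (u - a))"
      proof (rule ode_gronwall[where d' = "\<lambda>u. F' u (y u)" and b = b])
        show "(y has_vector_derivative F' v (y v)) (at v within {a..b})" if "v \<in> {a..b}" for v
          using y(1) that by (simp add: ode_solution_def)
        show "norm (F' v (y v)) \<le> L * norm (y v) + 0" if "v \<in> {a..b}" for v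
          using F'_lip[of v "y v" 0] sub[OF that] F_zero cp_id[of 0] r by (simp add: F'_def)
      qed (use L u in auto)
      also have "\<dots> \<le> norm \<eta> * D"
      proof -
        have "exp (L * (u - a)) \<le> D" unfolding D_def using u ab L by (auto intro!: mult_left_mono)
        then show ?thesis using y by (auto intro!: mult_left_mono)
      qed
      finally show ?thesis by (simp add: mult.commute)
    qed
    have y_r: "norm (y u) \<le> r" if u: "u \<in> {a..b}" for u
    proof -
      have "D * norm \<eta> \<le> r" using \<eta> D by (simp add: field_simps)
      with y_le[OF u] show ?thesis by linarith
    qed
    have yF: "ode_solution F {a..b} y"
      using y(1) y_r unfolding ode_solution_def F'_def by (auto simp: cp_id)
    obtain w where w: "ode_solution (\<lambda>u y. A u *v y) {a..b} w" "w a = \<eta>"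
      using linear_solution[OF ab] by metis
    have "norm (y b - w b) \<le> (norm (y a - w a) + e * (D * norm \<eta>) * (b - a)) * exp (K * (b - a))"
    proof (rule ode_gronwall[where d' = "\<lambda>u. F u (y u) - A u *v w u" and b = b])
      show "((\<lambda>u. y u - w u) has_vector_derivative F u (y u) - A u *v w u) (at u within {a..b})"
        if "u \<in> {a..b}" for u
        using yF w(1) that unfolding ode_solution_def by (intro has_vector_derivative_diff) auto
      show "norm (F u (y u) - A u *v w u) \<le> K * norm (y u - w u) + e * (D * norm \<eta>)" if u: "u \<in> {a..b}" for u
      proof -
        have "norm (F u (y u) - A u *v y u) \<le> e * norm (y u)"
          by (rule r0) (use sub[OF u] y_r[OF u] r in auto)
        also have "\<dots> \<le> e * (D * norm \<eta>)" using y_le[OF u] e by simp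
        finally have "norm (F u (y u) - A u *v y u) \<le> e * (D * norm \<eta>)" .
        moreover have "norm (A u *v (y u - w u)) \<le> K * norm (y u - w u)"
          by (rule norm_A_le[OF sub[OF u]])
        moreover have "F u (y u) - A u *v w u = A u *v (y u - w u) + (F u (y u) - A u *v y u)"
          by (simp add: matrix_vector_mult_diff_distrib)
        ultimately show ?thesis by (simp only: norm_triangle_mono)
      qed
    qed (use ab e D K_nonneg in auto)
    also have "\<dots> \<le> (e * (D * norm \<eta>) * (b - a)) * C"
    proof -
      have "exp (K * (b - a)) \<le> C" unfolding C_def using ab K_nonneg by (auto intro!: mult_left_mono)
      then show ?thesis using y w e D ab by (auto intro!: mult_left_mono)
    qed
    also have "\<dots> = \<epsilon> * (b - a) * norm \<eta>" using D C_ge_1 by (simp add: e_def)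
    finally show "\<exists>y. ode_solution F {a..b} y \<and> y a = \<eta> \<and> norm (y b - S b a \<eta>) \<le> \<epsilon> * (b - a) * norm \<eta>"
      using yF S_eq[OF w(1) ab] y w by auto
  qed
qed

lemma ode_flow_near_linear:
  assumes "\<epsilon> > 0"
  shows "\<exists>\<delta>>0. \<forall>a b \<eta>. 0 \<le> a \<longrightarrow> a \<le> b \<longrightarrow> b \<le> T \<longrightarrow> norm \<eta> \<le> \<delta> \<longrightarrow>
    norm (ode_flow F b a \<eta> - S b a \<eta>) \<le> \<epsilon> * (b - a) * norm \<eta>"
  using solution_near_linear[OF assms] ode_flow_eq by metis

text \<open>Once the nodes are O(\<alpha>(h)), a step of length h differs from the propagator by at
  most e h M \<alpha>(h); transport to \<open>T\<close> costs at most the factor \<open>C\<close>,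
  and the steps have total length at most \<open>T\<close>. The threshold for \<open>h\<close>
  precedes the choice of \<open>v\<close>, as the supremum over all sequences requires.\<close>

lemma approx_near_linear_sum:
  assumes \<alpha>: "admissible_rate \<alpha>" and "\<epsilon> > 0"
  shows "\<forall>\<^sub>F h in at_right 0. \<forall>v. (\<forall>n\<ge>1. norm (v n) \<le> 1) \<longrightarrow>
    norm (approx F \<alpha> h v T - (h * \<alpha> h) *\<^sub>R (\<Sum>j=1..nat \<lfloor>T / h\<rfloor>. S T (real j * h) (v j))) \<le> \<epsilon> * \<alpha> h"
proof -
  \<comment> \<open>The nodes obey the discrete Gronwall bound t \<alpha>(h) exp((K + 1) t) with t =
    k h, and \<open>M\<close> is its coefficient at t = T. The exponent takes \<open>K\<close> from
    the propagator and 1 from the flow error.\<close>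
  define M where "M = T * exp ((K + 1) * T)"
  have M: "M \<ge> 0" using T_nonneg by (simp add: M_def)
  \<comment> \<open>The total error is e (C + 1) T M \<alpha>(h): \<open>C\<close> shares from the
    full steps, one from the incomplete last step. The summand 1 keeps \<open>B\<close>
    positive.\<close>
  define B where "B = (C + 1) * T * M + 1"
  have B: "B > 0" using M T_nonneg C_ge_1 by (simp add: B_def add_nonneg_pos)
  define e where "e = min 1 (\<epsilon> / B)"
  have e: "e > 0" "e \<le> 1" "e * B \<le> \<epsilon>" using assms B by (auto simp: e_def min_def field_simps)
  obtain \<delta> where \<delta>: "\<delta> > 0" "\<And>a b \<eta>. 0 \<le> a \<Longrightarrow> a \<le> b \<Longrightarrow> b \<le> T \<Longrightarrow> norm \<eta> \<le> \<delta> \<Longrightarrow>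
    norm (ode_flow F b a \<eta> - S b a \<eta>) \<le> e * (b - a) * norm \<eta>"
    using ode_flow_near_linear[OF e(1)] by blast
  have "((\<lambda>h. M * \<alpha> h) \<longlongrightarrow> M * 0) (at_right 0)"
    by (intro tendsto_intros admissible_rate_tendsto[OF \<alpha>])
  then have "\<forall>\<^sub>F h in at_right 0. M * \<alpha> h < \<delta>"
    using \<delta>(1) by (intro order_tendstoD) auto
  moreover have "\<forall>\<^sub>F h in at_right (0::real). h > 0"
    by (simp add: eventually_at_right_less)
  ultimately show ?thesis
  proof eventually_elim
    case (elim h)
    then have h: "h > 0" and small: "M * \<alpha> h < \<delta>" by auto
    have \<alpha>h: "\<alpha> h > 0" using \<alpha> h by (rule admissible_rate_pos)
    show ?case
    proof (intro allI impI)
      fix v :: "nat \<Rightarrow> real^'d" assume v: "\<forall>n\<ge>1. norm (v n) \<le> 1"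
      define y where "y = approx_node F \<alpha> h v"
      \<comment> \<open>Also used inside the next induction: it puts the node below \<delta>, where
        flow and propagator can be compared for the following step.\<close>
      have y_le: "norm (y k) \<le> M * \<alpha> h" if "real k * h \<le> T" "norm (y k) \<le> real k * h * \<alpha> h * exp ((K + 1) * (real k * h))" for k
      proof -
        have "real k * h * \<alpha> h * exp ((K + 1) * (real k * h)) \<le> T * \<alpha> h * exp ((K + 1) * T)"
          using that(1) h \<alpha>h K_nonneg T_nonneg by (intro mult_mono) auto
        then show ?thesis using that(2) by (simp add: M_def mult_ac)
      qed
      have bound: "norm (y k) \<le> real k * h * \<alpha> h * exp ((K + 1) * (real k * h))" if "real k * h \<le> T" for k
        using that
      proof (induction k)
        case 0 then show ?case by (simp add: y_def)
      next
        case (Suc k)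
        let ?a = "real k * h" and ?b = "real (Suc k) * h"
        have ab: "0 \<le> ?a" "?a \<le> ?b" "?b \<le> T" "?b - ?a = h" using h Suc.prems by (auto simp: algebra_simps)
        have IH: "norm (y k) \<le> ?a * \<alpha> h * exp ((K + 1) * ?a)" using Suc.IH ab by linarith
        have "norm (y k) \<le> \<delta>" using y_le[OF _ IH] ab small by linarith
        then have "norm (ode_flow F ?b ?a (y k) - S ?b ?a (y k)) \<le> e * h * norm (y k)"
          using \<delta>(2)[OF ab(1-3)] ab(4) by simp
        then have "norm (ode_flow F ?b ?a (y k)) \<le> norm (S ?b ?a (y k)) + e * h * norm (y k)"
          using norm_triangle_sub[of "ode_flow F ?b ?a (y k)" "S ?b ?a (y k)"] by linarith
        also have "\<dots> \<le> exp (K * h) * norm (y k) + exp (K * h) * (h * norm (y k))"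
        proof (rule add_mono)
          show "norm (S ?b ?a (y k)) \<le> exp (K * h) * norm (y k)" using norm_S_le[OF ab(1-3)] ab(4) by simp
          \<comment> \<open>Thus exp(K h) + e h is at most exp(K h) (1 + h), hence at most exp((K +
            1) h).\<close>
          have "e \<le> exp (K * h)" by (rule order_trans[OF e(2)]) (use K_nonneg h in simp)
          then show "e * h * norm (y k) \<le> exp (K * h) * (h * norm (y k))"
            using h by (simp add: mult.assoc mult_right_mono)
        qed
        also have "\<dots> = exp (K * h) * (1 + h) * norm (y k)" by (simp add: algebra_simps)
        also have "\<dots> \<le> exp (K * h) * exp h * norm (y k)"
          using exp_ge_add_one_self[of h] by (intro mult_right_mono mult_left_mono) auto
        also have "\<dots> = exp ((K + 1) * h) * norm (y k)" by (simp add: algebra_simps flip: exp_add)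
        also have "\<dots> \<le> exp ((K + 1) * h) * (?a * \<alpha> h * exp ((K + 1) * ?a))"
          using IH by simp
        also have "\<dots> = ?a * \<alpha> h * exp ((K + 1) * ?b)" by (simp add: algebra_simps flip: exp_add)
        finally have 1: "norm (ode_flow F ?b ?a (y k)) \<le> ?a * \<alpha> h * exp ((K + 1) * ?b)" .
        have "norm ((h * \<alpha> h) *\<^sub>R v (Suc k)) \<le> h * \<alpha> h * 1"
          using v h \<alpha>h by (auto intro!: mult_left_mono)
        also have "\<dots> \<le> h * \<alpha> h * exp ((K + 1) * ?b)"
          using K_nonneg h \<alpha>h by (intro mult_left_mono) auto
        finally have "norm (y (Suc k)) \<le> ?a * \<alpha> h * exp ((K + 1) * ?b) + h * \<alpha> h * exp ((K + 1) * ?b)"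
          using 1 by (simp add: y_def norm_triangle_le)
        then show ?case by (simp add: algebra_simps)
      qed
      have y_M: "norm (y k) \<le> M * \<alpha> h" if "real k * h \<le> T" for k
        using y_le[OF that bound[OF that]] .
      have near: "norm (ode_flow F b (real k * h) (y k) - S b (real k * h) (y k)) \<le> e * (b - real k * h) * (M * \<alpha> h)"
        if "real k * h \<le> b" "b \<le> T" for k b
      proof -
        have "norm (ode_flow F b (real k * h) (y k) - S b (real k * h) (y k)) \<le> e * (b - real k * h) * norm (y k)"
          using that h y_M[of k] small by (intro \<delta>) auto
        also have "\<dots> \<le> e * (b - real k * h) * (M * \<alpha> h)"
          using that e y_M[of k] by (intro mult_left_mono) auto
        finally show ?thesis .
      qed
      have sum: "norm (S T (real k * h) (y k) - (h * \<alpha> h) *\<^sub>R (\<Sum>j=1..k. S T (real j * h) (v j)))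
          \<le> C * e * (real k * h) * (M * \<alpha> h)" if "real k * h \<le> T" for k
        using that
      proof (induction k)
        case 0 then show ?case using linear_0[OF S_linear[of 0 T]] T_nonneg by (simp add: y_def)
      next
        case (Suc k)
        let ?a = "real k * h" and ?b = "real (Suc k) * h"
        have ab: "0 \<le> ?a" "?a \<le> ?b" "?b \<le> T" "?b - ?a = h" using h Suc.prems by (auto simp: algebra_simps)
        let ?R = "ode_flow F ?b ?a (y k) - S ?b ?a (y k)"
        let ?\<Sigma> = "\<lambda>k. \<Sum>j=1..k. S T (real j * h) (v j)"
        have lin: "linear (S T ?b)" using ab by (intro S_linear) auto
        have "y (Suc k) = S ?b ?a (y k) + ?R + (h * \<alpha> h) *\<^sub>R v (Suc k)" by (simp add: y_def)
        then have "S T ?b (y (Suc k)) = S T ?a (y k) + S T ?b ?R + (h * \<alpha> h) *\<^sub>R S T ?b (v (Suc k))"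
          using S_semigroup[of ?a ?b T "y k"] ab by (simp only: linear_add[OF lin] linear_scale[OF lin])
        then have "S T ?b (y (Suc k)) - (h * \<alpha> h) *\<^sub>R ?\<Sigma> (Suc k)
            = (S T ?a (y k) - (h * \<alpha> h) *\<^sub>R ?\<Sigma> k) + S T ?b ?R"
          by (simp add: scaleR_add_right)
        moreover have "norm (S T ?b ?R) \<le> C * (e * h * (M * \<alpha> h))"
        proof (rule order_trans[OF norm_S_le_C])
          show "C * norm ?R \<le> C * (e * h * (M * \<alpha> h))"
            using near[of k ?b] ab C_ge_1 by (intro mult_left_mono) auto
        qed (use ab in auto)
        moreover have "norm (S T ?a (y k) - (h * \<alpha> h) *\<^sub>R ?\<Sigma> k) \<le> C * e * ?a * (M * \<alpha> h)"
          using Suc.IH ab by linarith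
        ultimately have "norm (S T ?b (y (Suc k)) - (h * \<alpha> h) *\<^sub>R ?\<Sigma> (Suc k))
            \<le> C * e * ?a * (M * \<alpha> h) + C * (e * h * (M * \<alpha> h))"
          by (simp only: norm_triangle_mono)
        then show ?case by (simp add: algebra_simps)
      qed
      define n where "n = nat \<lfloor>T / h\<rfloor>"
      have "real n \<le> T / h" using T_nonneg h by (simp add: n_def)
      then have n: "real n * h \<le> T" using h by (simp add: field_simps)
      \<comment> \<open>From the last grid point to \<open>T\<close> there is flow without a
        perturbation, so one more comparison, with \<open>b = T\<close>, closes the
        estimate.\<close>
      have "approx F \<alpha> h v T = ode_flow F T (real n * h) (y n)" by (simp add: approx_def n_def y_def Let_def)
      then have "norm (approx F \<alpha> h v T - (h * \<alpha> h) *\<^sub>R (\<Sum>j=1..n. S T (real j * h) (v j)))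
          \<le> e * (T - real n * h) * (M * \<alpha> h) + C * e * (real n * h) * (M * \<alpha> h)"
        using norm_triangle_le[OF add_mono[OF near[OF n order_refl] sum[OF n]]] by simp
      also have "\<dots> \<le> e * T * (M * \<alpha> h) + C * e * T * (M * \<alpha> h)"
        using n h e M \<alpha>h C_ge_1 by (intro add_mono mult_right_mono mult_left_mono) auto
      also have "\<dots> = (e * (B - 1)) * \<alpha> h" by (simp add: B_def algebra_simps)
      also have "\<dots> \<le> \<epsilon> * \<alpha> h" using e \<alpha>h by (intro mult_right_mono) (auto simp: algebra_simps)
      finally show "norm (approx F \<alpha> h v T - (h * \<alpha> h) *\<^sub>R (\<Sum>j=1..nat \<lfloor>T / h\<rfloor>. S T (real j * h) (v j))) \<le> \<epsilon> * \<alpha> h"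
        by (simp add: n_def)
    qed
  qed
qed

end

section \<open>Riemann sums and duality\<close>

text \<open>On each cell the integrand stays within \<epsilon> of its right end value. The
  oscillation bound is an explicit hypothesis so that a family of integrands with a common modulus
  of continuity shares one threshold for \<open>h\<close>.\<close>

lemma right_riemann_sum_near:
  fixes g :: "real \<Rightarrow> 'a::euclidean_space"
  assumes cont: "continuous_on {0..real n * h} g" and h: "h > 0"
    and osc: "\<And>s r. s \<in> {0..real n * h} \<Longrightarrow> r \<in> {0..real n * h} \<Longrightarrow> \<bar>s - r\<bar> \<le> h \<Longrightarrow> norm (g s - g r) \<le> \<epsilon>"
  shows "norm (h *\<^sub>R (\<Sum>j=1..n. g (real j * h)) - integral {0..real n * h} g) \<le> \<epsilon> * (real n * h)"
  using assms
proof (induction n)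
  case 0 then show ?case by simp
next
  case (Suc n)
  let ?a = "real n * h" and ?b = "real (Suc n) * h"
  have ab: "0 \<le> ?a" "?a \<le> ?b" "?b - ?a = h" using h by (auto simp: algebra_simps)
  have sub: "{?a..?b} \<subseteq> {0..?b}" unfolding atLeastatMost_subset_iff using ab(1) by blast
  with Suc.prems(1) have int: "g integrable_on {0..?b}" "g integrable_on {?a..?b}"
    by (blast intro: integrable_continuous_real continuous_on_subset)+
  have IH: "norm (h *\<^sub>R (\<Sum>j=1..n. g (real j * h)) - integral {0..?a} g) \<le> \<epsilon> * ?a"
  proof (rule Suc.IH)
    show "continuous_on {0..?a} g" using Suc.prems(1) by (rule continuous_on_subset) (use ab in auto)
    show "norm (g s - g r) \<le> \<epsilon>" if "s \<in> {0..?a}" "r \<in> {0..?a}" "\<bar>s - r\<bar> \<le> h" for s r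
      using that ab by (intro Suc.prems(3)) auto
  qed (rule h)
  have "((\<lambda>s. g ?b - g s) has_integral (h *\<^sub>R g ?b - integral {?a..?b} g)) {?a..?b}"
    using has_integral_diff[OF has_integral_const_real integrable_integral[OF int(2)], of "g ?b"] ab
    by simp
  then have "h *\<^sub>R g ?b - integral {?a..?b} g = integral {?a..?b} (\<lambda>s. g ?b - g s)"
    by (rule integral_unique[symmetric])
  also have "norm \<dots> \<le> \<epsilon> * (?b - ?a)"
  proof (rule integral_bound[OF ab(2)])
    show "continuous_on {?a..?b} (\<lambda>s. g ?b - g s)"
      by (intro continuous_intros continuous_on_subset[OF Suc.prems(1)] sub)
    show "norm (g ?b - g s) \<le> \<epsilon>" if "s \<in> {?a..?b}" for s
      using subsetD[OF sub that] that ab by (intro Suc.prems(3)) auto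
  qed
  finally have "norm (h *\<^sub>R g ?b - integral {?a..?b} g) \<le> \<epsilon> * h" by (simp only: ab(3))
  moreover have "integral {0..?b} g = integral {0..?a} g + integral {?a..?b} g"
    using Henstock_Kurzweil_Integration.integral_combine[OF ab(1,2) int(1)] by simp
  then have "h *\<^sub>R (\<Sum>j=1..Suc n. g (real j * h)) - integral {0..?b} g
      = (h *\<^sub>R (\<Sum>j=1..n. g (real j * h)) - integral {0..?a} g) + (h *\<^sub>R g ?b - integral {?a..?b} g)"
    by (simp add: scaleR_add_right)
  ultimately have "norm (h *\<^sub>R (\<Sum>j=1..Suc n. g (real j * h)) - integral {0..?b} g) \<le> \<epsilon> * ?a + \<epsilon> * h"
    using IH by (simp only: norm_triangle_mono)
  then show ?case by (simp add: algebra_simps)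
qed

lemma eventually_right_riemann_sum_near:
  fixes g :: "real \<Rightarrow> 'a::euclidean_space"
  assumes cont: "continuous_on {0..T} g" and T: "0 \<le> T" and "\<epsilon> > 0"
  shows "\<forall>\<^sub>F h in at_right 0. norm (h *\<^sub>R (\<Sum>j=1..nat \<lfloor>T / h\<rfloor>. g (real j * h)) - integral {0..T} g) \<le> \<epsilon>"
proof -
  have "bounded (g ` {0..T})"
    by (intro compact_imp_bounded compact_continuous_image cont) simp
  then obtain B where B: "\<And>s. s \<in> {0..T} \<Longrightarrow> norm (g s) \<le> B" "B > 0"
    unfolding bounded_pos by blast
  \<comment> \<open>Half of \<epsilon> pays for the full cells, the other half for the rest beyond
    the last grid point; \<open>T + 1\<close> instead of \<open>T\<close> admits
    \<open>T = 0\<close>.\<close>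
  define e where "e = \<epsilon> / (2 * (T + 1))"
  have e: "e > 0" "e * T \<le> \<epsilon> / 2" using assms by (auto simp: e_def field_simps)
  have "uniformly_continuous_on {0..T} g" using cont by (intro compact_uniformly_continuous) auto
  then obtain d where d: "d > 0" "\<And>s r. s \<in> {0..T} \<Longrightarrow> r \<in> {0..T} \<Longrightarrow> dist s r < d \<Longrightarrow> dist (g s) (g r) < e"
    unfolding uniformly_continuous_on_def using e by meson
  have "\<forall>\<^sub>F h in at_right (0::real). h \<in> {0<..<min d (\<epsilon> / (2 * B))}"
    by (rule eventually_at_right_real) (use d B assms in auto)
  then show ?thesis
  proof eventually_elim
    case (elim h)
    then have h: "h > 0" "h < d" "h < \<epsilon> / (2 * B)" by auto
    define n where "n = nat \<lfloor>T / h\<rfloor>"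
    have n: "real n * h \<le> T" "T - real n * h \<le> h"
    proof -
      have "real n = of_int \<lfloor>T / h\<rfloor>" unfolding n_def using T h by simp
      then have "real n \<le> T / h" "T / h < real n + 1" by linarith+
      then show "real n * h \<le> T" "T - real n * h \<le> h" using h by (auto simp: field_simps)
    qed
    have n0: "0 \<le> real n * h" using h by simp
    have "{0..real n * h} \<subseteq> {0..T}" "{real n * h..T} \<subseteq> {0..T}" using n n0 by auto
    then have c1: "continuous_on {0..real n * h} g" and c2: "continuous_on {real n * h..T} g"
      by (auto intro: continuous_on_subset[OF cont])
    have "norm (h *\<^sub>R (\<Sum>j=1..n. g (real j * h)) - integral {0..real n * h} g) \<le> e * (real n * h)"
    proof (rule right_riemann_sum_near[OF c1 h(1)])
      show "norm (g s - g r) \<le> e"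
        if "s \<in> {0..real n * h}" "r \<in> {0..real n * h}" "\<bar>s - r\<bar> \<le> h" for s r
        using d(2)[of s r] that n h by (simp add: dist_norm)
    qed
    also have "\<dots> \<le> e * T" using n e by simp
    finally have 1: "norm (h *\<^sub>R (\<Sum>j=1..n. g (real j * h)) - integral {0..real n * h} g) \<le> \<epsilon> / 2"
      using e by linarith
    have "norm (integral {real n * h..T} g) \<le> B * (T - real n * h)"
      by (rule integral_bound[OF n(1) c2]) (use B n0 in auto)
    also have "\<dots> \<le> B * h" using n B by simp
    also have "\<dots> \<le> \<epsilon> / 2" using h B by (simp add: field_simps)
    finally have 2: "norm (integral {real n * h..T} g) \<le> \<epsilon> / 2" .
    have "integral {0..T} g = integral {0..real n * h} g + integral {real n * h..T} g"
      using Henstock_Kurzweil_Integration.integral_combine[OF n0 n(1) integrable_continuous_real[OF cont]] by simp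
    then have diff: "h *\<^sub>R (\<Sum>j=1..n. g (real j * h)) - integral {0..T} g
        = (h *\<^sub>R (\<Sum>j=1..n. g (real j * h)) - integral {0..real n * h} g) - integral {real n * h..T} g" by simp
    have "norm (h *\<^sub>R (\<Sum>j=1..n. g (real j * h)) - integral {0..T} g) \<le> \<epsilon>"
      unfolding diff
      using 1 2 norm_triangle_ineq4[of "h *\<^sub>R (\<Sum>j=1..n. g (real j * h)) - integral {0..real n * h} g" "integral {real n * h..T} g"]
      by linarith
    then show ?case by (simp only: n_def)
  qed
qed

definition controls :: "real \<Rightarrow> (real \<Rightarrow> 'a::real_normed_vector) set" where
  "controls t = {v. continuous_on {0..t} v \<and> (\<forall>s\<in>{0..t}. norm (v s) \<le> 1)}"

section \<open>Adjoint propagators and nearly optimal controls\<close>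

context linear_ode
begin

lemma continuous_on_S:
  assumes v: "continuous_on {0..T} v"
  shows "continuous_on {0..T} (\<lambda>s. S T s (v s))"
  unfolding continuous_on_def
proof
  fix r assume r: "r \<in> {0..T}"
  let ?b = "\<lambda>s. K * C\<^sup>2 * \<bar>s - r\<bar> * norm (v s) + C * norm (v s - v r)"
  have "(v \<longlongrightarrow> v r) (at r within {0..T})" using v r by (auto simp: continuous_on_def)
  then have "(?b \<longlongrightarrow> K * C\<^sup>2 * \<bar>r - r\<bar> * norm (v r) + C * norm (v r - v r)) (at r within {0..T})"
    by (intro tendsto_intros)
  then have b: "(?b \<longlongrightarrow> 0) (at r within {0..T})" by simp
  have "\<forall>\<^sub>F s in at r within {0..T}. norm (S T s (v s) - S T r (v r)) \<le> ?b s"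
    unfolding eventually_at_filter
  proof (intro always_eventually allI impI)
    fix s assume s: "s \<in> {0..T}"
    have "S T s (v s) - S T r (v r) = (S T s (v s) - S T r (v s)) + S T r (v s - v r)"
      using r by (simp add: linear_diff[OF S_linear])
    then show "norm (S T s (v s) - S T r (v r)) \<le> ?b s"
      using S_lipschitz[OF s r] norm_S_le_C[of r T] r by (simp only: norm_triangle_mono) (simp add: norm_triangle_mono)
  qed
  from Lim_null_comparison[OF this b] show "((\<lambda>s. S T s (v s)) \<longlongrightarrow> S T r (v r)) (at r within {0..T})"
    by (simp add: LIM_zero_iff)
qed

text \<open>Pairing the difference \<open>w\<close> with itself moves the adjoints to the other
  side: |w|^2 is the inner product of \<open>S T s w - S T r w\<close> with \<open>p\<close>, and
  one factor |w| cancels.\<close>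

lemma adjoint_S_lipschitz:
  assumes "s \<in> {0..T}" "r \<in> {0..T}"
  shows "norm (adjoint (S T s) p - adjoint (S T r) p) \<le> K * C\<^sup>2 * \<bar>s - r\<bar> * norm p"
proof (cases "adjoint (S T s) p = adjoint (S T r) p")
  case True
  then show ?thesis using K_nonneg by simp
next
  case False
  define w where "w = adjoint (S T s) p - adjoint (S T r) p"
  have lin: "linear (S T s)" "linear (S T r)" using assms by (auto intro!: S_linear)
  have "norm w * norm w = w \<bullet> w" by (simp add: norm_eq_sqrt_inner)
  also have "\<dots> = w \<bullet> adjoint (S T s) p - w \<bullet> adjoint (S T r) p"
    by (simp add: w_def inner_diff_right)
  also have "\<dots> = (S T s w - S T r w) \<bullet> p"
    by (simp add: adjoint_works lin inner_diff_left)
  also have "\<dots> \<le> norm (S T s w - S T r w) * norm p" by (rule norm_cauchy_schwarz)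
  also have "\<dots> \<le> K * C\<^sup>2 * \<bar>s - r\<bar> * norm w * norm p"
    by (intro mult_right_mono S_lipschitz assms) auto
  finally have "norm w * norm w \<le> norm w * (K * C\<^sup>2 * \<bar>s - r\<bar> * norm p)" by (simp add: mult_ac)
  moreover have "norm w > 0" using False by (simp add: w_def)
  ultimately show ?thesis by (simp add: w_def)
qed

text \<open>The control \<open>w = q / (\<bar>q\<bar> + e)\<close> with \<open>q(s) = S(T,s)\<^sup>* p\<close> is nearly optimal in the direction \<open>p\<close>;
  the summand \<open>e\<close> makes it continuous.\<close>

lemma integral_norm_adjoint_S_le:
  assumes p: "norm p = 1" and e: "e > 0"
  obtains w where "w \<in> controls T"
    "integral {0..T} (\<lambda>s. norm (adjoint (S T s) p)) \<le> norm (integral {0..T} (\<lambda>s. S T s (w s))) + e * T"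
proof -
  define q where "q = (\<lambda>s. adjoint (S T s) p)"
  define w where "w = (\<lambda>s. q s /\<^sub>R (norm (q s) + e))"
  have pos: "norm (q s) + e > 0" for s using e by (simp add: add_nonneg_pos)
  have q: "continuous_on {0..T} q"
  proof (rule lipschitz_on_continuous_on[OF lipschitz_onI])
    show "dist (q s) (q r) \<le> K * C\<^sup>2 * dist s r" if "s \<in> {0..T}" "r \<in> {0..T}" for s r
      using adjoint_S_lipschitz[OF that, of p] p by (simp add: q_def dist_norm)
  qed (use K_nonneg in auto)
  have w: "w \<in> controls T"
    unfolding controls_def w_def using pos e
    by (auto intro!: continuous_intros q simp: less_imp_neq[THEN not_sym] field_simps)
  then have int: "(\<lambda>s. S T s (w s)) integrable_on {0..T}"
    by (auto simp: controls_def intro!: integrable_continuous_real continuous_on_S)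
  have int_q: "(\<lambda>s. norm (q s)) integrable_on {0..T}"
    by (intro integrable_continuous_real continuous_intros q)
  have "integral {0..T} (\<lambda>s. norm (q s)) - e * T = integral {0..T} (\<lambda>s. norm (q s) - e)"
    using T_nonneg by (subst Henstock_Kurzweil_Integration.integral_diff[OF int_q]) (auto simp: mult.commute)
  also have "\<dots> \<le> integral {0..T} (\<lambda>s. S T s (w s) \<bullet> p)"
  proof (rule integral_le)
    show "(\<lambda>s. norm (q s) - e) integrable_on {0..T}" by (intro integrable_diff int_q) auto
    show "(\<lambda>s. S T s (w s) \<bullet> p) integrable_on {0..T}"
      using integrable_linear[OF int bounded_linear_inner_left[of p]] by (simp add: o_def)
    fix s assume s: "s \<in> {0..T}"
    have "S T s (w s) \<bullet> p = w s \<bullet> q s"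
      unfolding q_def using s by (simp add: adjoint_works S_linear)
    also have "\<dots> = (norm (q s))\<^sup>2 / (norm (q s) + e)"
      by (simp add: w_def divide_inverse power2_norm_eq_inner mult.commute)
    \<comment> \<open>Because (|q| - e) (|q| + e) = |q|^2 - e^2 is at most |q|^2.\<close>
    also have "\<dots> \<ge> norm (q s) - e"
      using pos[of s] by (simp add: field_simps power2_eq_square)
    finally show "norm (q s) - e \<le> S T s (w s) \<bullet> p" by simp
  qed
  also have "\<dots> = integral {0..T} (\<lambda>s. S T s (w s)) \<bullet> p"
    using integral_linear[OF int bounded_linear_inner_left[of p]] by (simp add: o_def)
  also have "\<dots> \<le> norm (integral {0..T} (\<lambda>s. S T s (w s)))"
    using norm_cauchy_schwarz[of _ p] p by simp
  finally show ?thesis using that[OF w] by (simp add: q_def)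
qed

text \<open>Let \<open>p\<close> be the direction of the sum. By Cauchy-Schwarz each summand
  contributes at most |S(T,s)^* p| along \<open>p\<close>; the Riemann sum of this function is close
  to its integral, which a nearly optimal control recovers. Although \<open>p\<close> depends on
  \<open>v\<close>, the threshold for \<open>h\<close> does not, since \<open>L\<close> serves all
  unit vectors.\<close>

lemma eventually_discrete_sum_le_integral:
  assumes "\<epsilon> > 0"
  shows "\<forall>\<^sub>F h in at_right 0. \<forall>v. (\<forall>n\<ge>1. norm (v n) \<le> 1) \<longrightarrow> (\<exists>w\<in>controls T.
    norm (h *\<^sub>R (\<Sum>j=1..nat \<lfloor>T / h\<rfloor>. S T (real j * h) (v j))) \<le> norm (integral {0..T} (\<lambda>s. S T s (w s))) + \<epsilon>)"
proof -
  define e where "e = \<epsilon> / (2 * (T + 1))"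
  have e: "e > 0" "e * T \<le> \<epsilon> / 2" using T_nonneg assms by (auto simp: e_def field_simps)
  define L where "L = K * C\<^sup>2"
  have L: "L \<ge> 0" using K_nonneg by (simp add: L_def)
  have "\<forall>\<^sub>F h in at_right (0::real). h \<in> {0<..<e / (L + 1)}"
    by (rule eventually_at_right_real) (use e L in auto)
  then show ?thesis
  proof eventually_elim
    case (elim h)
    then have h: "h > 0" "L * h \<le> e" using L by (auto simp: field_simps)
    define n where "n = nat \<lfloor>T / h\<rfloor>"
    have "real n \<le> T / h" unfolding n_def using T_nonneg h by simp
    then have n: "real n * h \<le> T" using h by (simp add: field_simps)
    show ?case
    proof (intro allI impI)
      fix v :: "nat \<Rightarrow> real^'d" assume v: "\<forall>n\<ge>1. norm (v n) \<le> 1"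
      define x where "x = h *\<^sub>R (\<Sum>j=1..n. S T (real j * h) (v j))"
      have "\<exists>w\<in>controls T. norm x \<le> norm (integral {0..T} (\<lambda>s. S T s (w s))) + \<epsilon>"
      \<comment> \<open>The vector 0 has no direction, but then any control will do.\<close>
      proof (cases "x = 0")
        case True
        then show ?thesis using assms by (intro bexI[of _ "\<lambda>_. 0"]) (auto simp: controls_def)
      next
        case False
        define p where "p = sgn x"
        have p: "norm p = 1" "norm x = x \<bullet> p"
          using False by (auto simp: p_def norm_sgn sgn_div_norm norm_eq_sqrt_inner[of x] real_div_sqrt simp flip: divide_inverse_commute)
        define g where "g = (\<lambda>s. norm (adjoint (S T s) p))"
        have g_lip: "norm (g s - g r) \<le> L * \<bar>s - r\<bar>" if "s \<in> {0..T}" "r \<in> {0..T}" for s r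
          using adjoint_S_lipschitz[OF that, of p] p norm_triangle_ineq3[of "adjoint (S T s) p" "adjoint (S T r) p"]
          by (simp add: g_def L_def)
        have g: "continuous_on {0..T} g"
          by (rule lipschitz_on_continuous_on[OF lipschitz_onI[OF _ L]]) (use g_lip in \<open>simp add: dist_norm\<close>)
        obtain w where w: "w \<in> controls T"
          "integral {0..T} g \<le> norm (integral {0..T} (\<lambda>s. S T s (w s))) + e * T"
          using integral_norm_adjoint_S_le[OF p(1) e(1)] unfolding g_def by blast
        have "norm x = h * (\<Sum>j=1..n. S T (real j * h) (v j) \<bullet> p)"
          unfolding p(2) by (simp add: x_def inner_sum_left)
        also have "\<dots> \<le> h * (\<Sum>j=1..n. g (real j * h))"
        proof (intro mult_left_mono sum_mono)
          fix j assume j: "j \<in> {1..n}"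
          have "real j * h \<le> real n * h" using j h by simp
          then have "real j * h \<le> T" using n by linarith
          then have "linear (S T (real j * h))" using h by (intro S_linear) auto
          then have "S T (real j * h) (v j) \<bullet> p = v j \<bullet> adjoint (S T (real j * h)) p"
            by (simp add: adjoint_works)
          also have "\<dots> \<le> norm (v j) * g (real j * h)" unfolding g_def by (rule norm_cauchy_schwarz)
          also have "\<dots> \<le> 1 * g (real j * h)" using v j by (intro mult_right_mono) (auto simp: g_def)
          finally show "S T (real j * h) (v j) \<bullet> p \<le> g (real j * h)" by simp
        qed (use h in simp)
        also have "\<dots> \<le> integral {0..real n * h} g + e * (real n * h)"
        proof -
          have "norm (h *\<^sub>R (\<Sum>j=1..n. g (real j * h)) - integral {0..real n * h} g) \<le> e * (real n * h)"
          proof (rule right_riemann_sum_near[OF _ h(1)])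
            show "continuous_on {0..real n * h} g" by (rule continuous_on_subset[OF g]) (use n in auto)
            show "norm (g s - g r) \<le> e"
              if "s \<in> {0..real n * h}" "r \<in> {0..real n * h}" "\<bar>s - r\<bar> \<le> h" for s r
              using g_lip[of s r] mult_left_mono[OF that(3) L] that n h by auto
          qed
          then show ?thesis by (simp add: abs_le_iff)
        qed
        also have "\<dots> \<le> integral {0..T} g + e * T"
        \<comment> \<open>As \<open>g\<close> is nonnegative, extending the interval to
          \<open>T\<close> can only increase the integral.\<close>
        proof (intro add_mono integral_subset_le mult_left_mono)
          show "{0..real n * h} \<subseteq> {0..T}" using n by auto
          then show "g integrable_on {0..real n * h}"
            by (intro integrable_continuous_real continuous_on_subset[OF g])
          show "g integrable_on {0..T}" by (intro integrable_continuous_real g)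
        qed (use n e in \<open>auto simp: g_def\<close>)
        also have "\<dots> \<le> norm (integral {0..T} (\<lambda>s. S T s (w s))) + \<epsilon>" using w e by linarith
        finally show ?thesis using w by blast
      qed
      then show "\<exists>w\<in>controls T. norm (h *\<^sub>R (\<Sum>j=1..nat \<lfloor>T / h\<rfloor>. S T (real j * h) (v j)))
          \<le> norm (integral {0..T} (\<lambda>s. S T s (w s))) + \<epsilon>"
        by (simp add: x_def n_def)
    qed
  qed
qed

end

section \<open>The formula for E at the terminal time\<close>

context linearized_ode
begin

text \<open>The upper bound uses the discrete estimate uniformly in \<open>v\<close>. The lower
  bound samples one continuous control on the grid, so that its Riemann sums converge to the
  integral. The rate \<alpha>(h) is a common factor and cancels.\<close>

theorem E_zero_eq:
  assumes \<alpha>: "admissible_rate \<alpha>"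
  shows "E_zero \<alpha> F T = (SUP w\<in>controls T. ereal (norm (integral {0..T} (\<lambda>s. S T s (w s)))))"
    (is "_ = ?V")
proof (rule antisym)
  have pos: "\<forall>\<^sub>F h in at_right (0::real). \<alpha> h > 0"
    using eventually_at_right_less[of "0::real"] by eventually_elim (rule admissible_rate_pos[OF \<alpha>])
  show "E_zero \<alpha> F T \<le> ?V"
  proof (rule ereal_le_epsilon2)
    fix \<epsilon> :: real assume \<epsilon>: "\<epsilon> > 0"
    then have \<epsilon>2: "\<epsilon> / 2 > 0" by simp
    show "E_zero \<alpha> F T \<le> ?V + ereal \<epsilon>"
      unfolding E_zero_def
    proof (rule Limsup_bounded)
      show "\<forall>\<^sub>F h in at_right 0. max_error F \<alpha> T h / ereal (\<alpha> h) \<le> ?V + ereal \<epsilon>"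
        using approx_near_linear_sum[OF \<alpha> \<epsilon>2] eventually_discrete_sum_le_integral[OF \<epsilon>2] pos
      proof eventually_elim
        case (elim h)
        note ap = elim(1)[THEN spec, THEN mp] and le = elim(2)[THEN spec, THEN mp] and \<alpha>h = elim(3)
        have "max_error F \<alpha> T h \<le> ereal (\<alpha> h) * (?V + ereal \<epsilon>)"
          unfolding max_error_def
        proof (rule SUP_least)
          fix y assume "y \<in> approximations F \<alpha> h"
          then obtain v where v: "y = approx F \<alpha> h v" "\<forall>n\<ge>1. norm (v n) \<le> 1"
            by (auto simp: approximations_def)
          let ?x = "\<Sum>j=1..nat \<lfloor>T / h\<rfloor>. S T (real j * h) (v j)"
          obtain w where w: "w \<in> controls T" "norm (h *\<^sub>R ?x) \<le> norm (integral {0..T} (\<lambda>s. S T s (w s))) + \<epsilon> / 2"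
            using le[OF v(2)] by blast
          have "norm (y T) \<le> norm ((h * \<alpha> h) *\<^sub>R ?x) + \<epsilon> / 2 * \<alpha> h"
            using ap[OF v(2)] norm_triangle_sub[of "y T" "(h * \<alpha> h) *\<^sub>R ?x"] v(1) by simp
          also have "(h * \<alpha> h) *\<^sub>R ?x = \<alpha> h *\<^sub>R (h *\<^sub>R ?x)" by simp
          also have "norm (\<alpha> h *\<^sub>R (h *\<^sub>R ?x)) = \<alpha> h * norm (h *\<^sub>R ?x)" using \<alpha>h by (simp only: norm_scaleR abs_of_pos)
          also have "\<dots> + \<epsilon> / 2 * \<alpha> h \<le> \<alpha> h * (norm (integral {0..T} (\<lambda>s. S T s (w s))) + \<epsilon> / 2) + \<epsilon> / 2 * \<alpha> h"
            using w \<alpha>h by (intro add_right_mono mult_left_mono) auto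
          also have "\<dots> = \<alpha> h * (norm (integral {0..T} (\<lambda>s. S T s (w s))) + \<epsilon>)" by (simp add: algebra_simps)
          finally have "ereal (norm (y T)) \<le> ereal (\<alpha> h) * (ereal (norm (integral {0..T} (\<lambda>s. S T s (w s)))) + ereal \<epsilon>)"
            by simp
          also have "\<dots> \<le> ereal (\<alpha> h) * (?V + ereal \<epsilon>)"
            using \<alpha>h w by (intro ereal_mult_left_mono add_right_mono SUP_upper) auto
          finally show "ereal (norm (y T)) \<le> ereal (\<alpha> h) * (?V + ereal \<epsilon>)" .
        qed
        then show ?case using \<alpha>h by (subst ereal_divide_le_pos) auto
      qed
    qed
  qed
  show "?V \<le> E_zero \<alpha> F T"
  proof (rule SUP_least, rule ereal_le_epsilon2)
    fix w :: "real \<Rightarrow> real^'d" and \<epsilon> :: real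
    assume w: "w \<in> controls T" and \<epsilon>: "\<epsilon> > 0"
    then have \<epsilon>2: "\<epsilon> / 2 > 0" by simp
    have cont: "continuous_on {0..T} (\<lambda>s. S T s (w s))"
      using w by (auto simp: controls_def intro: continuous_on_S)
    let ?I = "norm (integral {0..T} (\<lambda>s. S T s (w s)))"
    have ev: "\<forall>\<^sub>F h in at_right 0. ereal (?I - \<epsilon>) \<le> max_error F \<alpha> T h / ereal (\<alpha> h)"
      using approx_near_linear_sum[OF \<alpha> \<epsilon>2] eventually_right_riemann_sum_near[OF cont T_nonneg \<epsilon>2] pos
        eventually_at_right_less[of "0::real"]
    proof eventually_elim
      case (elim h)
      note ap = elim(1)[THEN spec, THEN mp] and near = elim(2) and \<alpha>h = elim(3) and h = elim(4)
      define n where "n = nat \<lfloor>T / h\<rfloor>"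
      have "real n \<le> T / h" unfolding n_def using T_nonneg h by simp
      then have n: "real n * h \<le> T" using h by (simp add: field_simps)
      \<comment> \<open>Outside [0,T] the control need not be bounded by 1, whereas an admissible
        sequence is at every index; hence the default 0.\<close>
      define v where "v = (\<lambda>j. if j \<le> n then w (real j * h) else 0)"
      have v: "norm (v j) \<le> 1" for j
      proof (cases "j \<le> n")
        case True
        then have "real j * h \<le> real n * h" using h by simp
        then have "real j * h \<le> T" using n by linarith
        then have "real j * h \<in> {0..T}" using h by simp
        with True w show ?thesis by (auto simp: v_def controls_def)
      qed (simp add: v_def)
      let ?x = "\<Sum>j=1..n. S T (real j * h) (w (real j * h))"
      have sum: "(\<Sum>j=1..n. S T (real j * h) (v j)) = ?x"
        by (intro sum.cong) (auto simp: v_def)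
      have "norm (approx F \<alpha> h v T - (h * \<alpha> h) *\<^sub>R ?x) \<le> \<epsilon> / 2 * \<alpha> h"
        using ap[of v] v unfolding n_def[symmetric] sum by blast
      then have "norm ((h * \<alpha> h) *\<^sub>R ?x) \<le> norm (approx F \<alpha> h v T) + \<epsilon> / 2 * \<alpha> h"
        using norm_triangle_sub[of "(h * \<alpha> h) *\<^sub>R ?x" "approx F \<alpha> h v T"] by (simp add: norm_minus_commute)
      moreover have "norm ((h * \<alpha> h) *\<^sub>R ?x) = \<alpha> h * norm (h *\<^sub>R ?x)"
        using \<alpha>h h by (simp add: abs_mult)
      moreover have "\<alpha> h * (?I - \<epsilon> / 2) \<le> \<alpha> h * norm (h *\<^sub>R ?x)"
        using near \<alpha>h norm_triangle_sub[of "integral {0..T} (\<lambda>s. S T s (w s))" "h *\<^sub>R ?x"]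
        by (intro mult_left_mono) (auto simp: norm_minus_commute simp flip: n_def)
      ultimately have "\<alpha> h * (?I - \<epsilon> / 2) \<le> norm (approx F \<alpha> h v T) + \<epsilon> / 2 * \<alpha> h"
        by linarith
      then have "ereal (\<alpha> h * (?I - \<epsilon>)) \<le> ereal (norm (approx F \<alpha> h v T))"
        by (simp add: algebra_simps)
      also have "\<dots> \<le> max_error F \<alpha> T h"
        unfolding max_error_def by (rule SUP_upper) (use v in \<open>auto simp: approximations_def\<close>)
      finally show ?case using \<alpha>h by (subst ereal_le_divide_pos) auto
    qed
    \<comment> \<open>The bound holds for all small \<open>h\<close>, so it already holds for the
      lower limit.\<close>
    have "ereal (?I - \<epsilon>) \<le> Liminf (at_right 0) (\<lambda>h. max_error F \<alpha> T h / ereal (\<alpha> h))"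
      by (rule Liminf_bounded[OF ev])
    also have "\<dots> \<le> E_zero \<alpha> F T"
      unfolding E_zero_def by (rule Liminf_le_Limsup) (rule trivial_limit_at_right_real)
    finally have "ereal (?I - \<epsilon>) + ereal \<epsilon> \<le> E_zero \<alpha> F T + ereal \<epsilon>" by (rule add_right_mono)
    then show "ereal ?I \<le> E_zero \<alpha> F T + ereal \<epsilon>" by simp
  qed
qed

end

section \<open>Continuously differentiable right-hand sides\<close>

text \<open>Only partial derivatives are given, so the increment is made one coordinate at a time,
  with the mean value inequality on each edge. The factor \<open>(real CARD('d))\<^sup>2\<close>
  counts pairs of a component and a coordinate.\<close>

lemma partials_increment:
  fixes g :: "real^'d \<Rightarrow> real^'d" and D :: "real^'d \<Rightarrow> real^'d^'d" and M :: "real^'d^'d"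
  assumes der: "\<And>x i j. ((\<lambda>r. g (x + r *\<^sub>R axis j 1) $ i) has_real_derivative D x $ i $ j) (at 0)"
    and near: "\<And>z. norm (z - y) \<le> norm d \<Longrightarrow> norm (D z - M) \<le> \<epsilon>"
  shows "norm (g (y + d) - g y - M *v d) \<le> \<epsilon> * (real CARD('d))\<^sup>2 * norm d"
proof -
  define P where "P = (\<lambda>J. \<chi> k. if k \<in> J then d $ k else 0)"
  have coord: "\<bar>g (y + P J) $ i - g y $ i - (\<Sum>j\<in>J. M $ i $ j * d $ j)\<bar> \<le> (\<Sum>j\<in>J. \<epsilon> * \<bar>d $ j\<bar>)" for i J
  proof (induction J rule: finite_induct[OF finite])
    case 1
    then show ?case by (simp add: P_def vec_eq_iff zero_vec_def[symmetric])
  next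
    case (2 j J)
    \<comment> \<open>Removing the slope \<open>M $ i $ j\<close> leaves a derivative that is an
      entry of \<open>D z - M\<close>, so at most \<epsilon> in modulus.\<close>
    define \<phi> where "\<phi> = (\<lambda>r. g (y + P J + r *\<^sub>R axis j 1) $ i - M $ i $ j * r)"
    have "norm (\<phi> (d $ j) - \<phi> 0) \<le> \<epsilon> * norm (d $ j - 0)"
    proof (rule field_differentiable_bound[where S = "closed_segment 0 (d $ j)"])
      fix r assume r: "r \<in> closed_segment 0 (d $ j)"
      let ?z = "y + P J + r *\<^sub>R axis j 1"
      have "((\<lambda>h. g (?z + h *\<^sub>R axis j 1) $ i) has_real_derivative D ?z $ i $ j) (at 0)" by (rule der)
      then have "((\<lambda>r. g (y + P J + r *\<^sub>R axis j 1) $ i) has_real_derivative D ?z $ i $ j) (at r)"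
        using DERIV_shift[of "\<lambda>r. g (y + P J + r *\<^sub>R axis j 1) $ i" "D ?z $ i $ j" 0 r]
        by (simp add: algebra_simps)
      from DERIV_diff[OF this DERIV_cmult_Id]
      show "(\<phi> has_field_derivative D ?z $ i $ j - M $ i $ j) (at r within closed_segment 0 (d $ j))"
        unfolding \<phi>_def by (rule has_field_derivative_at_within)
      \<comment> \<open>The edges stay where \<open>near\<close> applies, since every component of
        the displacement is dominated by that of \<open>d\<close>.\<close>
      have "norm (P J + r *\<^sub>R axis j 1) \<le> norm d"
      proof (rule norm_le_componentwise_cart)
        have "\<bar>r\<bar> \<le> \<bar>d $ j\<bar>" using r by (auto simp: closed_segment_eq_real_ivl split: if_splits)
        then show "norm ((P J + r *\<^sub>R axis j 1) $ k) \<le> norm (d $ k)" for k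
          using 2 by (auto simp: P_def axis_def)
      qed
      then have "norm (D ?z - M) \<le> \<epsilon>" by (intro near) (simp add: algebra_simps)
      moreover have "\<bar>(D ?z - M) $ i $ j\<bar> \<le> norm (D ?z - M)"
        using component_le_norm_cart[of "(D ?z - M) $ i" j] Finite_Cartesian_Product.norm_nth_le[of "D ?z - M" i]
        by (simp only: order_trans)
      ultimately show "norm (D ?z $ i $ j - M $ i $ j) \<le> \<epsilon>" by simp
    qed auto
    moreover have "P (insert j J) = P J + d $ j *\<^sub>R axis j 1"
      using 2 by (auto simp: P_def axis_def vec_eq_iff)
    ultimately have "\<bar>g (y + P (insert j J)) $ i - g (y + P J) $ i - M $ i $ j * d $ j\<bar> \<le> \<epsilon> * \<bar>d $ j\<bar>"
      by (simp add: \<phi>_def algebra_simps)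
    with 2 show ?case by simp
  qed
  have "P UNIV = d" by (simp add: P_def vec_eq_iff)
  have \<epsilon>: "\<epsilon> \<ge> 0" using order_trans[OF norm_ge_zero near[of y]] by simp
  have "norm (g (y + d) - g y - M *v d) \<le> (\<Sum>i\<in>UNIV. \<bar>(g (y + d) - g y - M *v d) $ i\<bar>)"
    by (rule norm_le_l1_cart)
  also have "\<dots> \<le> (\<Sum>i\<in>(UNIV::'d set). \<Sum>j\<in>(UNIV::'d set). \<epsilon> * norm d)"
  proof (rule sum_mono)
    fix i
    have "\<bar>(g (y + d) - g y - M *v d) $ i\<bar> \<le> (\<Sum>j\<in>UNIV. \<epsilon> * \<bar>d $ j\<bar>)"
      using coord[of UNIV i] \<open>P UNIV = d\<close> by (simp add: matrix_vector_mult_def)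
    also have "\<dots> \<le> (\<Sum>j\<in>(UNIV::'d set). \<epsilon> * norm d)"
      by (intro sum_mono mult_left_mono component_le_norm_cart \<epsilon>)
    finally show "\<bar>(g (y + d) - g y - M *v d) $ i\<bar> \<le> (\<Sum>j\<in>(UNIV::'d set). \<epsilon> * norm d)" .
  qed
  finally show ?thesis by (simp add: power2_eq_square mult_ac)
qed

text \<open>Near \<open>y0\<close> the Lipschitz bound is uniform in time, so a change of state is
  small at all times at once; the change of time then takes place at the fixed state
  \<open>y0\<close>.\<close>

lemma (in lipschitz_ode) continuous_on_joint:
  assumes cont: "\<And>z. continuous_on {0..T} (\<lambda>t. F t z)"
  shows "continuous_on ({0..T} \<times> UNIV) (\<lambda>(u, y). F u y)"
  unfolding continuous_on_def
proof
  fix p assume "p \<in> {0..T} \<times> (UNIV :: (real^'d) set)"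
  then obtain u0 y0 where p: "p = (u0, y0)" "u0 \<in> {0..T}" by auto
  let ?W = "at p within {0..T} \<times> (UNIV :: (real^'d) set)"
  obtain L where L: "L \<ge> 0" "\<And>u y z. u \<in> {0..T} \<Longrightarrow> y \<in> cball 0 (norm y0 + 1) \<Longrightarrow> z \<in> cball 0 (norm y0 + 1) \<Longrightarrow>
      norm (F u y - F u z) \<le> L * norm (y - z)"
    using locally_lipschitz[of "norm y0 + 1"] by blast
  have fs: "(fst \<longlongrightarrow> u0) ?W" "(snd \<longlongrightarrow> y0) ?W"
    using tendsto_fst[OF tendsto_ident_at, of p] tendsto_snd[OF tendsto_ident_at, of p] p by auto
  have dom: "\<forall>\<^sub>F q in ?W. q \<in> {0..T} \<times> UNIV" by (auto simp: eventually_at_filter)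
  have "\<forall>\<^sub>F q in ?W. fst q \<in> {0..T}" by (rule eventually_mono[OF dom]) auto
  then have "((\<lambda>q. F (fst q) y0) \<longlongrightarrow> F u0 y0) ?W"
    by (rule continuous_on_tendsto_compose[OF cont fs(1) p(2)])
  then have "((\<lambda>q. L * norm (snd q - y0) + norm (F (fst q) y0 - F u0 y0)) \<longlongrightarrow>
      L * norm (y0 - y0) + norm (F u0 y0 - F u0 y0)) ?W"
    using fs by (intro tendsto_intros)
  then have b: "((\<lambda>q. L * norm (snd q - y0) + norm (F (fst q) y0 - F u0 y0)) \<longlongrightarrow> 0) ?W" by simp
  have "\<forall>\<^sub>F q in ?W. dist (snd q) y0 < 1" using fs(2) by (rule tendstoD) simp
  with dom have "\<forall>\<^sub>F q in ?W. norm ((case q of (u, y) \<Rightarrow> F u y) - F u0 y0)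
      \<le> L * norm (snd q - y0) + norm (F (fst q) y0 - F u0 y0)"
  proof eventually_elim
    case (elim q)
    obtain u y where q: "q = (u, y)" by fastforce
    have "norm y \<le> norm y0 + 1" using elim norm_triangle_sub[of y y0] by (simp add: q dist_norm)
    then have "norm (F u y - F u y0) \<le> L * norm (y - y0)" using elim by (intro L) (auto simp: q)
    then have "norm ((F u y - F u y0) + (F u y0 - F u0 y0)) \<le> L * norm (y - y0) + norm (F u y0 - F u0 y0)"
      by (intro norm_triangle_mono) auto
    then show ?case by (simp add: q)
  qed
  from Lim_null_comparison[OF this b]
  show "((\<lambda>(u, y). F u y) \<longlongrightarrow> (case p of (u, y) \<Rightarrow> F u y)) ?W"
    by (simp add: LIM_zero_iff p)
qed

section \<open>Linearization along the given solution and the derivative of its flow\<close>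

locale smooth_ode =
  fixes f :: "real \<Rightarrow> real^'d \<Rightarrow> real^'d" and Df :: "real \<Rightarrow> real^'d \<Rightarrow> real^'d^'d"
    and x :: "real \<Rightarrow> real^'d" and T :: real
  assumes T_nonneg: "0 \<le> T"
    and continuous_on_f: "\<And>z. continuous_on {0..T} (\<lambda>t. f t z)"
    and partials: "has_state_partials f Df"
    and continuous_on_Df: "continuous_on ({0..T} \<times> UNIV) (\<lambda>(t, z). Df t z)"
    and solution: "ode_solution f {0..T} x"
begin

definition G where "G = (\<lambda>u y. f u (y + x u) - f u (x u))"

lemma increment:
  assumes "0 \<le> u" "\<And>z. norm (z - y) \<le> norm d \<Longrightarrow> norm (Df u z - M) \<le> \<epsilon>"
  shows "norm (f u (y + d) - f u y - M *v d) \<le> \<epsilon> * (real CARD('d))\<^sup>2 * norm d"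
  by (rule partials_increment[OF _ assms(2)])
    (use partials assms(1) in \<open>auto simp: has_state_partials_def\<close>)

lemma continuous_on_x: "continuous_on {0..T} x"
  using solution by (rule ode_solution_continuous_on)

lemma compact_continuous_Df: "continuous_on ({0..T} \<times> cball 0 R) (\<lambda>(t, z). Df t z)"
  by (rule continuous_on_subset[OF continuous_on_Df]) auto

sublocale f: lipschitz_ode f T
proof
  fix M :: real
  \<comment> \<open>A point whose distance from \<open>z\<close> is at most
    \<open>norm (y - z)\<close> has norm at most \<open>3 * M\<close>. With a bound for
    \<open>Df\<close> there, comparison with the zero matrix turns \<open>increment\<close> into a
    Lipschitz estimate.\<close>
  have "bounded ((\<lambda>(t, z). Df t z) ` ({0..T} \<times> cball 0 (3 * M)))"
    by (intro compact_imp_bounded compact_continuous_image compact_continuous_Df compact_Times) auto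
  then obtain B where B: "B > 0" "\<And>p. p \<in> {0..T} \<times> cball 0 (3 * M) \<Longrightarrow> norm (case p of (t, z) \<Rightarrow> Df t z) \<le> B"
    unfolding bounded_pos by auto
  show "\<exists>L\<ge>0. \<forall>u\<in>{0..T}. \<forall>y\<in>cball 0 M. \<forall>z\<in>cball 0 M. norm (f u y - f u z) \<le> L * norm (y - z)"
  proof (intro exI[of _ "B * (real CARD('d))\<^sup>2"] conjI ballI)
    fix u :: real and y z :: "real^'d" assume u: "u \<in> {0..T}" and yz: "y \<in> cball 0 M" "z \<in> cball 0 M"
    have "norm (f u (z + (y - z)) - f u z - 0 *v (y - z)) \<le> B * (real CARD('d))\<^sup>2 * norm (y - z)"
    proof (rule increment)
      fix w assume "norm (w - z) \<le> norm (y - z)"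
      then have "norm w \<le> 3 * M"
        using yz norm_triangle_ineq4[of y z] norm_triangle_sub[of w z] by simp
      then show "norm (Df u w - 0) \<le> B" using B(2)[of "(u, w)"] u by simp
    qed (use u in simp)
    then show "norm (f u y - f u z) \<le> B * (real CARD('d))\<^sup>2 * norm (y - z)" by simp
  qed (use B in simp)
qed

text \<open>Uniform continuity of \<open>Df\<close> on a compact set around the trajectory makes the
  linearization at \<open>x u\<close> uniform in \<open>u\<close>.\<close>

sublocale linearized_ode "\<lambda>u. Df u (x u)" G T
proof
  show "0 \<le> T" by (rule T_nonneg)
  have "continuous_on {0..T} (\<lambda>u. (\<lambda>(t, z). Df t z) (u, x u))"
    by (rule continuous_on_compose2[OF continuous_on_Df]) (auto intro!: continuous_intros continuous_on_x)
  then show "continuous_on {0..T} (\<lambda>u. Df u (x u))" by simp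
  have "bounded (x ` {0..T})"
    by (intro compact_imp_bounded compact_continuous_image continuous_on_x) simp
  then obtain X where X: "\<And>u. u \<in> {0..T} \<Longrightarrow> norm (x u) \<le> X"
    unfolding bounded_iff by blast
  show "\<exists>L\<ge>0. \<forall>u\<in>{0..T}. \<forall>y\<in>cball 0 M. \<forall>z\<in>cball 0 M. norm (G u y - G u z) \<le> L * norm (y - z)" for M
  proof -
    obtain L where L: "L \<ge> 0" "\<And>u y z. u \<in> {0..T} \<Longrightarrow> y \<in> cball 0 (M + X) \<Longrightarrow> z \<in> cball 0 (M + X) \<Longrightarrow>
        norm (f u y - f u z) \<le> L * norm (y - z)"
      using f.locally_lipschitz[of "M + X"] by blast
    show ?thesis
    proof (intro exI[of _ L] conjI ballI L(1))
      fix u :: real and y z :: "real^'d" assume u: "u \<in> {0..T}" and yz: "y \<in> cball 0 M" "z \<in> cball 0 M"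
      have "norm (f u (y + x u) - f u (z + x u)) \<le> L * norm ((y + x u) - (z + x u))"
        using X[OF u] yz u by (intro L) (auto intro: norm_triangle_mono)
      then show "norm (G u y - G u z) \<le> L * norm (y - z)" by (simp add: G_def)
    qed
  qed
  have fj: "continuous_on ({0..T} \<times> UNIV) (\<lambda>(u, y). f u y)"
    by (rule f.continuous_on_joint[OF continuous_on_f])
  have cx: "continuous_on ({0..T} \<times> UNIV) (\<lambda>p. x (fst p))"
    by (rule continuous_on_compose2[OF continuous_on_x]) (auto intro!: continuous_intros)
  have "continuous_on ({0..T} \<times> UNIV)
      (\<lambda>p. (\<lambda>(u, y). f u y) (fst p, snd p + x (fst p)) - (\<lambda>(u, y). f u y) (fst p, x (fst p)))"
    by (intro continuous_on_diff continuous_on_compose2[OF fj]) (auto intro!: continuous_intros cx)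
  then show "continuous_on ({0..T} \<times> UNIV) (\<lambda>(u, y). G u y)"
    by (simp add: G_def case_prod_beta)
  show "G u 0 = 0" for u by (simp add: G_def)
  fix \<epsilon> :: real assume \<epsilon>: "\<epsilon> > 0"
  define e where "e = \<epsilon> / (real CARD('d))\<^sup>2"
  have e: "e > 0" "e * (real CARD('d))\<^sup>2 = \<epsilon>" using \<epsilon> by (auto simp: e_def)
  have "uniformly_continuous_on ({0..T} \<times> cball 0 (X + 1)) (\<lambda>(t, z). Df t z)"
    by (intro compact_uniformly_continuous compact_continuous_Df compact_Times) auto
  then obtain \<delta> where \<delta>: "\<delta> > 0" "\<And>p q. p \<in> {0..T} \<times> cball 0 (X + 1) \<Longrightarrow> q \<in> {0..T} \<times> cball 0 (X + 1) \<Longrightarrow>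
      dist p q < \<delta> \<Longrightarrow> dist (case p of (t, z) \<Rightarrow> Df t z) (case q of (t, z) \<Rightarrow> Df t z) < e"
    unfolding uniformly_continuous_on_def using e(1) by meson
  show "\<exists>r>0. \<forall>u\<in>{0..T}. \<forall>y\<in>cball 0 r. norm (G u y - Df u (x u) *v y) \<le> \<epsilon> * norm y"
  \<comment> \<open>Radius 1 keeps \<open>x u + y\<close> in the ball of radius
    \<open>X + 1\<close>; half of \<delta> gives the strict inequality that uniform continuity asks
    for.\<close>
  proof (intro exI[of _ "min 1 (\<delta> / 2)"] conjI ballI)
    fix u :: real and y :: "real^'d" assume u: "u \<in> {0..T}" and y: "y \<in> cball 0 (min 1 (\<delta> / 2))"
    have "norm (f u (x u + y) - f u (x u) - Df u (x u) *v y) \<le> e * (real CARD('d))\<^sup>2 * norm y"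
    proof (rule increment)
      fix z assume z: "norm (z - x u) \<le> norm y"
      have "norm z \<le> X + 1" using X[OF u] y z norm_triangle_sub[of z "x u"] by simp
      moreover have "norm (z - x u) < \<delta>" using z y \<delta>(1) by simp
      ultimately have "dist (Df u z) (Df u (x u)) < e"
        using \<delta>(2)[of "(u, z)" "(u, x u)"] X[OF u] u by (simp add: dist_Pair_Pair dist_norm)
      then show "norm (Df u z - Df u (x u)) \<le> e" by (simp add: dist_norm)
    qed (use u in simp)
    then show "norm (G u y - Df u (x u) *v y) \<le> \<epsilon> * norm y"
      by (simp add: G_def e add.commute)
  qed (use \<delta> in simp)
qed

text \<open>Adding \<open>x\<close> turns solutions of the perturbation equation with field
  \<open>G\<close> into solutions for \<open>f\<close>, so \<open>solution_near_linear\<close> for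
  \<open>G\<close> is the remainder estimate of a derivative at \<open>x a\<close>. Dividing
  \<open>e\<close> by \<open>T + 1\<close> absorbs the factor \<open>b - a\<close>.\<close>

lemma flow_has_derivative:
  assumes ab: "0 \<le> a" "a \<le> b" "b \<le> T"
  shows "((\<lambda>\<xi>. ode_flow f b a \<xi>) has_derivative S b a) (at (x a))"
  unfolding has_derivative_at_alt
proof (intro conjI allI impI)
  show "bounded_linear (S b a)" using S_linear[OF ab] by (simp add: linear_conv_bounded_linear)
  fix e :: real assume e: "e > 0"
  have solx: "ode_solution f {a..b} x"
    using solution by (rule ode_solution_subset) (use ab in auto)
  obtain \<delta> where \<delta>: "\<delta> > 0" "\<And>\<eta>. norm \<eta> \<le> \<delta> \<Longrightarrow>
      \<exists>y. ode_solution G {a..b} y \<and> y a = \<eta> \<and> norm (y b - S b a \<eta>) \<le> e / (T + 1) * (b - a) * norm \<eta>"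
    using solution_near_linear[of "e / (T + 1)"] e T_nonneg ab by auto
  show "\<exists>d>0. \<forall>\<xi>. norm (\<xi> - x a) < d \<longrightarrow>
      norm (ode_flow f b a \<xi> - ode_flow f b a (x a) - S b a (\<xi> - x a)) \<le> e * norm (\<xi> - x a)"
  proof (intro exI[of _ \<delta>] conjI \<delta>(1) allI impI)
    fix \<xi> assume "norm (\<xi> - x a) < \<delta>"
    then obtain y where y: "ode_solution G {a..b} y" "y a = \<xi> - x a"
        "norm (y b - S b a (\<xi> - x a)) \<le> e / (T + 1) * (b - a) * norm (\<xi> - x a)"
      using \<delta>(2)[of "\<xi> - x a"] by auto
    have "ode_solution f {a..b} (\<lambda>u. y u + x u)"
      using has_vector_derivative_add[of y _ _ x] y(1) solx unfolding ode_solution_def G_def by fastforce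
    from f.ode_flow_eq[OF this ab] f.ode_flow_eq[OF solx ab] y(2)
    have diff: "ode_flow f b a \<xi> - ode_flow f b a (x a) - S b a (\<xi> - x a) = y b - S b a (\<xi> - x a)" by simp
    have "e / (T + 1) * (b - a) \<le> e / (T + 1) * (T + 1)"
      using ab e by (intro mult_left_mono) auto
    then have "e / (T + 1) * (b - a) \<le> e" using ab by simp
    from order_trans[OF y(3) mult_right_mono[OF this norm_ge_zero]] show "norm (ode_flow f b a \<xi> - ode_flow f b a (x a) - S b a (\<xi> - x a)) \<le> e * norm (\<xi> - x a)"
      by (simp only: diff)
  qed
qed

lemma jacobian_flow:
  assumes ab: "0 \<le> a" "a \<le> b" "b \<le> T"
  shows "jacobian (\<lambda>\<xi>. ode_flow f b a \<xi>) (at (x a)) *v w = S b a w"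
  unfolding jacobian_def frechet_derivative_at[OF flow_has_derivative[OF ab], symmetric]
  by (rule matrix_works[OF iffD2[OF linear_matrix_vector_mul_eq S_linear[OF ab]]])

end

text \<open>The linear field is its own linearization without error, so \<open>E_zero_eq\<close>
  covers the linear equation too.\<close>

lemma (in linear_ode) linearized_ode_linear: "linearized_ode A (\<lambda>u y. A u *v y) T"
proof
  have "continuous_on ({0..T} \<times> UNIV) (\<lambda>p. A (fst p) *v snd p)"
    by (intro continuous_on_matrix_vector_mult continuous_intros continuous_on_compose2[OF continuous_on_A]) auto
  then show "continuous_on ({0..T} \<times> UNIV) (\<lambda>(u, y). A u *v y)" by (simp add: case_prod_beta)
  show "A u *v 0 = 0" for u by simp
  show "\<exists>r>0. \<forall>u\<in>{0..T}. \<forall>y\<in>cball 0 r. norm (A u *v y - A u *v y) \<le> \<epsilon> * norm y" if "\<epsilon> > 0" for \<epsilon>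
    using that by (intro exI[of _ 1]) auto
qed

theorem corollary6p3:
  fixes f :: "real \<Rightarrow> real^'d \<Rightarrow> real^'d"
    and Df :: "real \<Rightarrow> real^'d \<Rightarrow> real^'d^'d"
    and x :: "real \<Rightarrow> real^'d"
    and x0 :: "real^'d"
    and \<alpha> :: "real \<Rightarrow> real"
  assumes "\<And>z. continuous_on {0..} (\<lambda>t. f t z)"
    and "has_state_partials f Df"
    and "continuous_on ({0..} \<times> UNIV) (\<lambda>(t, z). Df t z)"
    and "ode_solution f {0..} x"
    and "x 0 = x0"
    and "admissible_rate \<alpha>"
  shows "\<forall>t\<ge>0.
     E_solution \<alpha> f x t = E_zero \<alpha> (\<lambda>u y. Df u (x u) *v y) t \<and>
     E_solution \<alpha> f x t =
       (SUP v\<in>{v. continuous_on {0..t} v \<and> (\<forall>s\<in>{0..t}. norm (v s) \<le> 1)}.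
          ereal (norm (integral {0..t}
            (\<lambda>s. jacobian (\<lambda>\<xi>. ode_flow f t s \<xi>) (at (x s)) *v v s))))"
proof (intro allI impI)
  fix t :: real assume t: "t \<ge> 0"
  have sub: "{0..t} \<subseteq> {0..}" by auto
  interpret smooth_ode f Df x t
  proof
    show "continuous_on ({0..t} \<times> UNIV) (\<lambda>(t, z). Df t z)"
      using assms(3) by (rule continuous_on_subset) auto
  qed (use t assms continuous_on_subset[OF assms(1) sub] ode_solution_subset[OF assms(4) sub] in auto)
  \<comment> \<open>The same matrix function is passed in, so both suprema are formed with the same
    propagator \<open>S\<close>.\<close>
  interpret lin: linearized_ode "\<lambda>u. Df u (x u)" "\<lambda>u y. Df u (x u) *v y" t
    by (rule linearized_ode_linear)
  have "E_solution \<alpha> f x t = E_zero \<alpha> G t"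
    by (simp add: E_solution_def G_def)
  also have "\<dots> = (SUP v\<in>controls t. ereal (norm (integral {0..t} (\<lambda>s. S t s (v s)))))"
    by (rule E_zero_eq[OF assms(6)])
  finally have "E_solution \<alpha> f x t = (SUP v\<in>controls t. ereal (norm (integral {0..t} (\<lambda>s. S t s (v s)))))" .
  moreover have "E_zero \<alpha> (\<lambda>u y. Df u (x u) *v y) t
      = (SUP v\<in>controls t. ereal (norm (integral {0..t} (\<lambda>s. S t s (v s)))))"
    by (rule lin.E_zero_eq[OF assms(6)])
  moreover have "integral {0..t} (\<lambda>s. jacobian (\<lambda>\<xi>. ode_flow f t s \<xi>) (at (x s)) *v v s)
      = integral {0..t} (\<lambda>s. S t s (v s))" for v
    by (rule integral_cong) (auto intro!: jacobian_flow)
  ultimately show "E_solution \<alpha> f x t = E_zero \<alpha> (\<lambda>u y. Df u (x u) *v y) t \<and>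
     E_solution \<alpha> f x t =
       (SUP v\<in>{v. continuous_on {0..t} v \<and> (\<forall>s\<in>{0..t}. norm (v s) \<le> 1)}.
          ereal (norm (integral {0..t}
            (\<lambda>s. jacobian (\<lambda>\<xi>. ode_flow f t s \<xi>) (at (x s)) *v v s))))"
    by (simp add: controls_def)
qed

end
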